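(* Let $A\in\mathbb{R}^{n\times n}$ be invertible, let $W\in\mathbb{R}^{n\times n}$ be symmetric positive definite, and let $S$ be a random matrix with $n$ rows, with distribution $\mathcal{D}$, that has full column rank with probability $1$ and such that $\mathbf{E}[Z]$ is positive definite, where $$Z=A^TS(S^TAWA^TS)^{-1}S^TA.$$ Let $\rho=1-\lambda_{\min}\left(W^{1/2}\,\mathbf{E}[Z]\,W^{1/2}\right)$ and let $X_0\in\mathbb{R}^{n\times n}$. If $X_k$ is calculated in either one of these two ways: 1. applying $k$ iterations of Algorithm 1 (nonsymmetric row variant, defined in the context) started from $X_0$, 2. applying $k$ iterations of Algorithm 3 (symmetric variant, defined in the context) started from $X_0$, assuming $A$ and $X_0$ are symmetric, then $$\mathbf{E}\left[\left\|X_k-A^{-1}\right\|_{F(W^{-1})}^2\right]\le\rho^k\left\|X_0-A^{-1}\right\|_{F(W^{-1})}^2.$$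
   Context: The weighted Frobenius norm is $\|X\|_{F(W^{-1})}^2=\mathrm{Tr}(X^TW^{-1}XW^{-1})=\|W^{-1/2}XW^{-1/2}\|_F^2$, where $\|\cdot\|_F$ is the standard Frobenius norm. $\lambda_{\min}$ denotes the smallest eigenvalue and $I$ is the $n\times n$ identity. The number of columns of $S$ may itself be random. Algorithm 1: starting from a fixed $X_0\in\mathbb{R}^{n\times n}$, for $k=0,1,2,\dots$ sample an independent copy $S\sim\mathcal{D}$ (independent of all previous samples) and set $$X_{k+1}=X_k+WA^TS(S^TAWA^TS)^{-1}S^T(I-AX_k).$$ Algorithm 3 (for symmetric $A$ and symmetric $X_0$): for $k=0,1,2,\dots$ sample an independent copy $S\sim\mathcal{D}$, compute $\Lambda=S(S^TAWAS)^{-1}S^T$, $\Theta=\Lambda AW$, $M_k=X_kA-I$, and set $$X_{k+1}=X_k-M_k\Theta-(M_k\Theta)^T+\Theta^T(AX_kA-A)\Theta.$$ *)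

theory Defs
  imports
    "HOL-Probability.Probability"
    "Jordan_Normal_Form.Char_Poly"
    "Jordan_Normal_Form.Gauss_Jordan_Elimination"
    "Jordan_Normal_Form.DL_Rank"
begin

text \<open>
  Matrices are those of the \<^theory>\<open>Jordan_Normal_Form.Matrix\<close> library, whose dimensions are
  values: the sketch \<open>S\<close> may then have a random number of columns.
\<close>

text \<open>
  The measurable space of real matrices with \<open>n\<close> rows and an arbitrary number of columns: the
  disjoint union, over the number \<open>q\<close> of columns, of the Borel spaces of \<open>n \<times> q\<close> matrices.
  A random matrix with \<open>n\<close> rows is a measurable map into it.
\<close>
definition mat_borel :: "nat \<Rightarrow> real mat measure" where
  "mat_borel n = sigma (\<Union>q. carrier_mat n q)
     (range (carrier_mat n) \<union>
      {{S \<in> carrier_mat n q. S $$ (i, j) \<in> B} | q i j B. i < n \<and> j < q \<and> B \<in> sets borel})"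

definition mat_expectation :: "nat \<Rightarrow> 's measure \<Rightarrow> ('s \<Rightarrow> real mat) \<Rightarrow> real mat" where
  "mat_expectation n D Y = Matrix.mat n n (\<lambda>(i, j). \<integral>s. Y s $$ (i, j) \<partial>D)"

text \<open>
  The inverse as a total function. Where the inverse does not exist, the value is the zero matrix;
  below this convention is only relevant on the null event that the sketch does not have full
  column rank.
\<close>
definition mat_inv :: "real mat \<Rightarrow> real mat" where
  "mat_inv B = (case mat_inverse B of Some C \<Rightarrow> C | None \<Rightarrow> 0\<^sub>m (dim_row B) (dim_row B))"

definition full_col_rank :: "nat \<Rightarrow> real mat \<Rightarrow> bool" where
  "full_col_rank n S \<longleftrightarrow> vec_space.rank n S = dim_col S"

definition sym_mat :: "real mat \<Rightarrow> bool" where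
  "sym_mat B \<longleftrightarrow> transpose_mat B = B"

definition pos_def :: "nat \<Rightarrow> real mat \<Rightarrow> bool" where
  "pos_def n B \<longleftrightarrow> B \<in> carrier_mat n n \<and> sym_mat B \<and>
     (\<forall>v \<in> carrier_vec n. v \<noteq> 0\<^sub>v n \<longrightarrow> 0 < scalar_prod v (B *\<^sub>v v))"

text \<open>The unique positive definite square root of a positive definite matrix.\<close>
definition mat_sqrt :: "nat \<Rightarrow> real mat \<Rightarrow> real mat" where
  "mat_sqrt n B = (THE R. pos_def n R \<and> R * R = B)"

definition lambda_min :: "real mat \<Rightarrow> real" where
  "lambda_min B = Min {l. eigenvalue B l}"

definition mat_trace :: "real mat \<Rightarrow> real" where
  "mat_trace B = (\<Sum>i<dim_row B. B $$ (i, i))"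

text \<open>The norm \<open>\<parallel>X\<parallel>\<close> weighted by \<open>V\<close>, that is \<open>F(V)\<close>; it is used with \<open>V\<close> the inverse of \<open>W\<close>.\<close>
definition weighted_frob_norm :: "real mat \<Rightarrow> real mat \<Rightarrow> real" where
  "weighted_frob_norm V X = sqrt (mat_trace (transpose_mat X * V * X * V))"

definition sketch_Z :: "real mat \<Rightarrow> real mat \<Rightarrow> real mat \<Rightarrow> real mat" where
  "sketch_Z A W S =
     transpose_mat A * S *
       mat_inv (transpose_mat S * A * W * transpose_mat A * S) *
     transpose_mat S * A"

definition alg1_step :: "real mat \<Rightarrow> real mat \<Rightarrow> real mat \<Rightarrow> real mat \<Rightarrow> real mat" where
  "alg1_step A W S X =
     X + W * transpose_mat A * S *
           mat_inv (transpose_mat S * A * W * transpose_mat A * S) *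
         transpose_mat S * (1\<^sub>m (dim_row A) - A * X)"

definition alg3_step :: "real mat \<Rightarrow> real mat \<Rightarrow> real mat \<Rightarrow> real mat \<Rightarrow> real mat" where
  "alg3_step A W S X =
     (let \<Lambda> = S * mat_inv (transpose_mat S * A * W * A * S) * transpose_mat S;
          \<Theta> = \<Lambda> * A * W;
          Mk = X * A - 1\<^sub>m (dim_row A)
      in X - Mk * \<Theta> - transpose_mat (Mk * \<Theta>)
           + transpose_mat \<Theta> * (A * X * A - A) * \<Theta>)"

text \<open>The \<open>k\<close>-th iterate from \<open>X0\<close>; step number \<open>k\<close> uses the sketch \<open>s k\<close>.\<close>
primrec iterates :: "('s \<Rightarrow> 'x \<Rightarrow> 'x) \<Rightarrow> 'x \<Rightarrow> (nat \<Rightarrow> 's) \<Rightarrow> nat \<Rightarrow> 'x" where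
  "iterates step X0 s 0 = X0"
| "iterates step X0 s (Suc k) = step (s k) (iterates step X0 s k)"

end

theory Submission
  imports Defs
begin

text \<open>
  Write \<open>V\<close> for the inverse of \<open>W\<close>. Since \<open>Z W Z = Z\<close>, the map \<open>I - W Z\<close> is a projection that is
  orthogonal for the inner product of \<open>V\<close>: \<open>(I - W Z)\<^sup>T V (I - W Z) = V - Z\<close>. A step of Algorithm 1
  multiplies the error \<open>E\<close> by it from the left, so that the squared error drops by exactly
  \<open>Tr (E\<^sup>T Z E V)\<close>; Algorithm 3 additionally projects from the right, which can only decrease the
  norm further. As the new sketch is independent of the current iterate, the expected drop is that
  of \<open>Tr (E\<^sup>T \<^bold>E[Z] E V)\<close>, and by the Rayleigh bound for \<open>W\<^sup>1\<^sup>/\<^sup>2 \<^bold>E[Z] W\<^sup>1\<^sup>/\<^sup>2\<close> this is at least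
  \<open>(1 - \<rho>)\<close> times the current squared error.
\<close>

text \<open>The identity \<open>Z W Z = Z\<close> rests on \<open>G N G = G\<close> for the total
  inverse \<open>G\<close> of the Gram matrix \<open>N\<close>, which holds for singular
  \<open>N\<close> as well, where \<open>G = 0\<close>. The algebra is therefore valid pointwise,
  for each single sketch. The obstacle is integrability: a Gram matrix can be arbitrarily close to
  singular, so its inverse has no bound. The projection supplies one: \<open>Z\<close> and
  \<open>V - Z\<close> are both positive semidefinite, so the entries of \<open>Z\<close> are
  bounded through the diagonal of \<open>V\<close>, uniformly in the sketch and in its number of
  columns. The iterates are polynomials in such matrices, hence bounded, and every expectation
  exists. Independence is used entrywise. With \<open>E\<close> the current error and
  \<open>G = E V E^T\<close>, the drop is the sum of the products \<open>Z_ij G_ji\<close>, and the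
  expectation of each product factorizes; conditional expectations do not enter. Chaining the
  one-step estimates requires \<rho> to be nonnegative, which follows from the same estimate for the
  error matrix \<open>I\<close>. The square root is given by a description and the smallest
  eigenvalue by a minimum over a set; the spectral theorem gives both their meaning.\<close>

lemma mat_inv:
  assumes B: "B \<in> carrier_mat n n" and det: "det B \<noteq> 0"
  shows "mat_inv B \<in> carrier_mat n n" "B * mat_inv B = 1\<^sub>m n" "mat_inv B * B = 1\<^sub>m n"
proof -
  have "mat_inverse B \<noteq> None"
    using mat_inverse(1)[OF B, of "()"] det_non_zero_imp_unit[OF B det, of "()"] by blast
  then obtain C where "mat_inverse B = Some C" by blast
  then show "mat_inv B \<in> carrier_mat n n" "B * mat_inv B = 1\<^sub>m n" "mat_inv B * B = 1\<^sub>m n"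
    using mat_inverse(2)[OF B] by (auto simp: mat_inv_def)
qed

lemma mat_inv_singular:
  assumes B: "B \<in> carrier_mat n n" and det: "det B = 0"
  shows "mat_inv B = 0\<^sub>m n n"
proof (cases "mat_inverse B")
  case None
  then show ?thesis using B by (simp add: mat_inv_def)
next
  case (Some C)
  then have C: "B * C = 1\<^sub>m n" "C * B = 1\<^sub>m n" "C \<in> carrier_mat n n"
    using mat_inverse(2)[OF B] by blast+
  then have "det B * det C = 1"
    using det_mult[OF B C(3)] by simp
  then show ?thesis using det by simp
qed

lemma mat_inv_carrier: "B \<in> carrier_mat n n \<Longrightarrow> mat_inv B \<in> carrier_mat n n"
  using mat_inv(1) mat_inv_singular by (cases "det B = 0") auto

lemma mat_inv_eqI:
  assumes B: "B \<in> carrier_mat n n" and C: "C \<in> carrier_mat n n" and BC: "B * C = 1\<^sub>m n"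
  shows "mat_inv B = C"
proof -
  have "det B * det C = 1"
    using det_mult[OF B C] BC by simp
  then have det: "det B \<noteq> 0" by auto
  note inv = mat_inv[OF B det]
  have "mat_inv B = mat_inv B * (B * C)"
    using BC inv by simp
  also have "\<dots> = C"
    using assoc_mult_mat[OF inv(1) B C] inv(3) C by simp
  finally show ?thesis .
qed

text \<open>The convention \<open>inverse 0 = 0\<close> makes this formula agree with the zero value
  of \<open>mat_inv\<close> at singular matrices. It presents the inverse as a function of the
  entries without case distinction, which is what measurability needs.\<close>

lemma mat_inv_adjugate:
  assumes B: "B \<in> carrier_mat n n"
  shows "mat_inv B = inverse (det B) \<cdot>\<^sub>m adj_mat B"
proof (cases "det B = 0")
  case True
  then show ?thesis
    using adj_mat(1)[OF B] by (intro eq_matI) (auto simp: mat_inv_singular[OF B True])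
next
  case False
  have "B * (inverse (det B) \<cdot>\<^sub>m adj_mat B) = 1\<^sub>m n"
    using mult_smult_distrib[OF B adj_mat(1)[OF B]] adj_mat(2)[OF B] False
    by (auto intro!: eq_matI)
  then show ?thesis
    by (intro mat_inv_eqI[OF B]) (use adj_mat(1)[OF B] in auto)
qed

lemma sym_mat_mat_inv:
  assumes B: "B \<in> carrier_mat n n" and sym: "sym_mat B"
  shows "sym_mat (mat_inv B)"
proof (cases "det B = 0")
  case True
  then show ?thesis by (simp add: mat_inv_singular[OF B] sym_mat_def zero_transpose_mat)
next
  case False
  note inv = mat_inv[OF B False]
  have "B * transpose_mat (mat_inv B) = 1\<^sub>m n"
    using transpose_mult[OF inv(1) B] inv(3) sym by (simp add: sym_mat_def)
  then have "mat_inv B = transpose_mat (mat_inv B)"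
    by (intro mat_inv_eqI[OF B]) (use inv(1) in auto)
  then show ?thesis by (simp add: sym_mat_def)
qed

lemma sym_matD: "sym_mat B \<Longrightarrow> B \<in> carrier_mat n n \<Longrightarrow> i < n \<Longrightarrow> j < n \<Longrightarrow> B $$ (i, j) = B $$ (j, i)"
  unfolding sym_mat_def by (metis carrier_matD index_transpose_mat(1))

lemma sym_mat_congruence:
  assumes "B \<in> carrier_mat n n" "C \<in> carrier_mat n m" "sym_mat B"
  shows "sym_mat (transpose_mat C * B * C)"
  using assms transpose_mult[of "transpose_mat C * B" m n C m] transpose_mult[of "transpose_mat C" m n B n]
  by (auto simp: sym_mat_def)

lemma sym_mat_scalar_prod:
  assumes "B \<in> carrier_mat n n" "sym_mat B" "v \<in> carrier_vec n" "w \<in> carrier_vec n"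
  shows "(B *\<^sub>v v) \<bullet> w = v \<bullet> (B *\<^sub>v w)"
  using transpose_vec_mult_scalar[of B n n w v] assms by (simp add: sym_mat_def)

lemma scalar_prod_self_nonneg: "0 \<le> (v::real vec) \<bullet> v"
  by (auto simp: scalar_prod_def intro!: sum_nonneg)

lemma scalar_prod_self_eq_0: "(v::real vec) \<in> carrier_vec n \<Longrightarrow> v \<bullet> v = 0 \<longleftrightarrow> v = 0\<^sub>v n"
  by (auto simp: scalar_prod_def sum_nonneg_eq_0_iff intro!: eq_vecI)

lemma scalar_prod_self_pos: "(v::real vec) \<in> carrier_vec n \<Longrightarrow> v \<noteq> 0\<^sub>v n \<Longrightarrow> 0 < v \<bullet> v"
  using scalar_prod_self_nonneg[of v] scalar_prod_self_eq_0[of v n] by simp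

subsection \<open>The spectral theorem for real symmetric matrices\<close>

text \<open>The fundamental theorem of algebra gives a complex eigenvalue \<open>z\<close> with
  eigenvector \<open>x + i y\<close>. Comparing \<open>(B x) . y\<close> with
  \<open>x . (B y)\<close> leaves \<open>Im z * (x . x + y . y) = 0\<close>, so \<open>z\<close> is
  real, and whichever of \<open>x\<close> and \<open>y\<close> is nonzero is a real
  eigenvector.\<close>

lemma sym_mat_has_eigenvector:
  assumes B: "B \<in> carrier_mat n n" and sym: "sym_mat B" and n: "0 < n"
  obtains v l where "eigenvector B v l"
proof -
  define C where "C = map_mat complex_of_real B"
  have C: "C \<in> carrier_mat n n" using B by (simp add: C_def)
  have "degree (char_poly C) = n" using degree_monic_char_poly[OF C] by simp
  then obtain z where "poly (char_poly C) z = 0"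
    using fundamental_theorem_of_algebra[of "char_poly C"] n by (metis constant_degree not_gr0)
  then have "eigenvalue C z" using eigenvalue_root_char_poly[OF C] by simp
  then obtain v where v: "v \<in> carrier_vec n" "v \<noteq> 0\<^sub>v n" "C *\<^sub>v v = z \<cdot>\<^sub>v v"
    using C by (auto simp: eigenvalue_def eigenvector_def)
  define x where "x = map_vec Re v"
  define y where "y = map_vec Im v"
  have xy: "x \<in> carrier_vec n" "y \<in> carrier_vec n" using v by (auto simp: x_def y_def)
  have entry: "(\<Sum>j<n. complex_of_real (B $$ (i, j)) * v $ j) = z * v $ i" if "i < n" for i
  proof -
    have "(C *\<^sub>v v) $ i = (z \<cdot>\<^sub>v v) $ i" using v(3) by simp
    then show ?thesis
      using that v(1) B by (simp add: C_def scalar_prod_def atLeast0LessThan)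
  qed
  have Bx: "B *\<^sub>v x = Re z \<cdot>\<^sub>v x - Im z \<cdot>\<^sub>v y"
  proof (rule eq_vecI)
    fix i assume "i < dim_vec (Re z \<cdot>\<^sub>v x - Im z \<cdot>\<^sub>v y)"
    then have i: "i < n" using xy by simp
    show "(B *\<^sub>v x) $ i = (Re z \<cdot>\<^sub>v x - Im z \<cdot>\<^sub>v y) $ i"
      using arg_cong[OF entry[OF i], of Re] i v(1) B xy
      by (simp add: x_def y_def scalar_prod_def atLeast0LessThan)
  qed (use B xy in simp)
  have By: "B *\<^sub>v y = Re z \<cdot>\<^sub>v y + Im z \<cdot>\<^sub>v x"
  proof (rule eq_vecI)
    fix i assume "i < dim_vec (Re z \<cdot>\<^sub>v y + Im z \<cdot>\<^sub>v x)"
    then have i: "i < n" using xy by simp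
    show "(B *\<^sub>v y) $ i = (Re z \<cdot>\<^sub>v y + Im z \<cdot>\<^sub>v x) $ i"
      using arg_cong[OF entry[OF i], of Im] i v(1) B xy
      by (simp add: x_def y_def scalar_prod_def atLeast0LessThan)
  qed (use B xy in simp)
  have "(B *\<^sub>v x) \<bullet> y = x \<bullet> (B *\<^sub>v y)"
    by (rule sym_mat_scalar_prod[OF B sym xy])
  then have "Im z * (x \<bullet> x + y \<bullet> y) = 0"
    unfolding Bx By using xy
    by (simp add: minus_scalar_prod_distrib[of _ n] scalar_prod_add_distrib[of _ n] algebra_simps)
  moreover have "x \<noteq> 0\<^sub>v n \<or> y \<noteq> 0\<^sub>v n"
  proof (rule ccontr)
    assume "\<not> ?thesis"
    then have "x $ i = 0" "y $ i = 0" if "i < n" for i using that by auto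
    then have "v = 0\<^sub>v n"
      using v(1) by (intro eq_vecI) (auto simp: x_def y_def complex_eq_iff)
    then show False using v(2) by simp
  qed
  then have "0 < x \<bullet> x + y \<bullet> y"
    using scalar_prod_self_pos xy scalar_prod_self_nonneg[of x] scalar_prod_self_nonneg[of y]
    by (meson add_nonneg_pos add_pos_nonneg)
  ultimately have "Im z = 0" by simp
  then have "B *\<^sub>v x = Re z \<cdot>\<^sub>v x" "B *\<^sub>v y = Re z \<cdot>\<^sub>v y"
    unfolding Bx By using xy by (auto intro!: eq_vecI)
  then show thesis
    using that \<open>x \<noteq> 0\<^sub>v n \<or> y \<noteq> 0\<^sub>v n\<close> B xy unfolding eigenvector_def by auto
qed

text \<open>The reflection in the hyperplane orthogonal to \<open>w = u - e_0\<close> exchanges the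
  unit vectors \<open>e_0\<close> and \<open>u\<close>. It is a symmetric orthogonal matrix with
  first column \<open>u\<close>, so no orthonormal basis has to be completed. For
  \<open>u = e_0\<close> the vector \<open>w\<close> vanishes and the identity serves.\<close>

lemma householder:
  fixes u :: "real vec"
  assumes u: "u \<in> carrier_vec n" "u \<bullet> u = 1" and n: "0 < n"
  obtains H where "H \<in> carrier_mat n n" "sym_mat H" "H * H = 1\<^sub>m n" "H *\<^sub>v unit_vec n 0 = u"
proof (cases "u = unit_vec n 0")
  case True
  then show ?thesis using that[of "1\<^sub>m n"] by (simp add: sym_mat_def)
next
  case False
  define w where "w = u - unit_vec n 0"
  have w: "w \<in> carrier_vec n" using u by (simp add: w_def)
  have "w \<noteq> 0\<^sub>v n"
  proof
    assume "w = 0\<^sub>v n"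
    have "u $ i = unit_vec n 0 $ i" if "i < n" for i
      using arg_cong[OF \<open>w = 0\<^sub>v n\<close>, of "\<lambda>v. v $ i"] that u by (simp add: w_def)
    then have "u = unit_vec n 0" using u by (intro eq_vecI) auto
    then show False using False by simp
  qed
  then have pos: "0 < w \<bullet> w" by (rule scalar_prod_self_pos[OF w])
  define c where "c = 2 / (w \<bullet> w)"
  define H where "H = mat n n (\<lambda>(i, j). (if i = j then 1 else 0) - c * w $ i * w $ j)"
  have H: "H \<in> carrier_mat n n" by (simp add: H_def)
  have sum_w: "(\<Sum>k<n. w $ k * w $ k) = w \<bullet> w"
    using w by (simp add: scalar_prod_def atLeast0LessThan)
  have "sym_mat H"
    by (auto simp: sym_mat_def H_def intro!: eq_matI)
  moreover have "H * H = 1\<^sub>m n"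
  proof (rule eq_matI)
    fix i j assume "i < dim_row (1\<^sub>m n)" "j < dim_col (1\<^sub>m n)"
    then have ij: "i < n" "j < n" by auto
    have "(H * H) $$ (i, j) =
      (\<Sum>k<n. ((if i = k then 1 else 0) - c * w $ i * w $ k) * ((if k = j then 1 else 0) - c * w $ k * w $ j))"
      using ij H by (simp add: H_def scalar_prod_def atLeast0LessThan)
    also have "\<dots> = (\<Sum>k<n. (if k = i then (if i = j then 1 else 0) - c * w $ i * w $ j else 0)
        - (if k = j then c * w $ i * w $ j else 0) + c * c * w $ i * w $ j * (w $ k * w $ k))"
      by (intro sum.cong) (auto simp: algebra_simps)
    also have "\<dots> = (if i = j then 1 else 0) - 2 * c * w $ i * w $ j + c * c * w $ i * w $ j * (w \<bullet> w)"
      using ij by (simp add: sum.distrib sum_subtractf sum_distrib_left[symmetric] sum_w)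
    also have "\<dots> = (if i = j then 1 else 0)"
      using pos by (simp add: c_def)
    finally show "(H * H) $$ (i, j) = 1\<^sub>m n $$ (i, j)" using ij by simp
  qed (use H in auto)
  moreover have "H *\<^sub>v unit_vec n 0 = u"
  proof (rule eq_vecI)
    fix i assume "i < dim_vec u"
    then have i: "i < n" using u by simp
    \<comment> \<open>The unit length of \<open>u\<close> enters here:
      \<open>w . w = 2 - 2 u_0 = -2 w_0\<close>, hence \<open>c * w_0 = -1\<close>, and the first
      column of \<open>H\<close> is \<open>e_0 + w = u\<close>.\<close>
    have "w \<bullet> w = u \<bullet> u - 2 * u $ 0 + 1"
      using u n by (simp add: w_def minus_scalar_prod_distrib[of _ n] scalar_prod_minus_distrib[of _ n])
    then have "w \<bullet> w = - 2 * w $ 0" using u n by (simp add: w_def)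
    then have "c * w $ 0 = -1" using pos by (simp add: c_def field_simps)
    then have "c * w $ i * w $ 0 = - w $ i" by (metis mult.commute mult.left_commute mult_minus1)
    then show "(H *\<^sub>v unit_vec n 0) $ i = u $ i"
      using i n u by (simp add: H_def w_def)
  qed (use H u in simp)
  ultimately show ?thesis using that H by blast
qed

text \<open>Deflation: a reflection moves a unit eigenvector to \<open>e_0\<close>, symmetry then
  splits off a 1 x 1 block, and the induction hypothesis diagonalizes the remaining block.\<close>

lemma sym_mat_diagonalize:
  assumes "B \<in> carrier_mat n n" "sym_mat B"
  shows "\<exists>Q d. Q \<in> carrier_mat n n \<and> transpose_mat Q * Q = 1\<^sub>m n \<and> Q * transpose_mat Q = 1\<^sub>m n \<and>
    transpose_mat Q * B * Q = mat n n (\<lambda>(i, j). if i = j then d i else 0)"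
  using assms
proof (induction n arbitrary: B)
  case 0
  then show ?case by (intro exI[of _ "1\<^sub>m 0"]) (auto intro!: eq_matI)
next
  case (Suc m)
  let ?n = "Suc m"
  note B = Suc.prems(1) and sym = Suc.prems(2)
  let ?e = "unit_vec ?n 0 :: real vec"
  obtain v l where "eigenvector B v l" using sym_mat_has_eigenvector[OF B sym] by auto
  then have v: "v \<in> carrier_vec ?n" "v \<noteq> 0\<^sub>v ?n" "B *\<^sub>v v = l \<cdot>\<^sub>v v"
    using B by (auto simp: eigenvector_def)
  define u where "u = (1 / sqrt (v \<bullet> v)) \<cdot>\<^sub>v v"
  have u: "u \<in> carrier_vec ?n" "u \<bullet> u = 1" "B *\<^sub>v u = l \<cdot>\<^sub>v u"
    using v scalar_prod_self_pos[OF v(1,2)] mult_mat_vec[OF B v(1)]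
    by (simp_all add: u_def smult_smult_assoc mult.commute)
  obtain H where H: "H \<in> carrier_mat ?n ?n" "sym_mat H" "H * H = 1\<^sub>m ?n" "H *\<^sub>v ?e = u"
    using householder[OF u(1,2)] by auto
  have Ht: "transpose_mat H = H" using H(2) by (simp add: sym_mat_def)
  define G where "G = H * B * H"
  have G: "G \<in> carrier_mat ?n ?n" "sym_mat G"
    using H B sym_mat_congruence[OF B H(1) sym] by (auto simp: G_def Ht)
  have "H *\<^sub>v u = ?e"
    using assoc_mult_mat_vec[OF H(1) H(1), of ?e] H(3,4) by simp
  moreover have "G *\<^sub>v ?e = H *\<^sub>v (B *\<^sub>v u)"
    using assoc_mult_mat_vec[of "H * B" ?n ?n H ?n ?e] assoc_mult_mat_vec[OF H(1) B u(1)] H(1,4) B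
    by (simp add: G_def)
  ultimately have Ge: "G *\<^sub>v ?e = l \<cdot>\<^sub>v ?e"
    using u(1,3) mult_mat_vec[OF H(1) u(1)] by simp
  have col0: "G $$ (i, 0) = (if i = 0 then l else 0)" if "i < ?n" for i
    using arg_cong[OF Ge, of "\<lambda>v. v $ i"] that G(1)
    by (simp add: row_carrier_vec[OF _ G(1)] split: if_splits)
  define C where "C = mat m m (\<lambda>(i, j). G $$ (Suc i, Suc j))"
  have C: "C \<in> carrier_mat m m" "sym_mat C"
    using sym_matD[OF G(2,1)] by (auto simp: C_def sym_mat_def intro!: eq_matI)
  define L where "L = mat 1 1 (\<lambda>_. l)"
  have L: "L \<in> carrier_mat 1 1" by (simp add: L_def)
  \<comment> \<open>The eigenvector equation for \<open>e_0\<close> fixes only the first column of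
    \<open>G\<close>; the zeros in the first row come from symmetry.\<close>
  have Gblock: "G = four_block_mat L (0\<^sub>m 1 m) (0\<^sub>m m 1) C"
  proof (rule eq_matI)
    fix i j
    assume "i < dim_row (four_block_mat L (0\<^sub>m 1 m) (0\<^sub>m m 1) C)"
      "j < dim_col (four_block_mat L (0\<^sub>m 1 m) (0\<^sub>m m 1) C)"
    then have ij: "i < ?n" "j < ?n" using L C by auto
    then show "G $$ (i, j) = four_block_mat L (0\<^sub>m 1 m) (0\<^sub>m m 1) C $$ (i, j)"
      using col0[of i] col0[of j] sym_matD[OF G(2,1), of 0 j]
      by (cases i; cases j) (auto simp: L_def C_def)
  qed (use G L C in auto)
  obtain Q d where Q: "Q \<in> carrier_mat m m" "transpose_mat Q * Q = 1\<^sub>m m" "Q * transpose_mat Q = 1\<^sub>m m"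
    and diag: "transpose_mat Q * C * Q = mat m m (\<lambda>(i, j). if i = j then d i else 0)"
    using Suc.IH[OF C] by blast
  define K where "K = four_block_mat (1\<^sub>m 1) (0\<^sub>m 1 m) (0\<^sub>m m 1) Q"
  have K: "K \<in> carrier_mat ?n ?n" using Q by (auto simp: K_def)
  have Kt: "transpose_mat K = four_block_mat (1\<^sub>m 1) (0\<^sub>m 1 m) (0\<^sub>m m 1) (transpose_mat Q)"
    unfolding K_def using Q by (subst transpose_four_block_mat[of _ 1 1 _ m _ m]) (auto simp: zero_transpose_mat)
  have one_block: "four_block_mat (1\<^sub>m 1) (0\<^sub>m 1 m) (0\<^sub>m m 1) (1\<^sub>m m) = 1\<^sub>m ?n"
    by (intro eq_matI) auto
  have KtK: "transpose_mat K * K = 1\<^sub>m ?n"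
    unfolding Kt unfolding K_def one_block[symmetric]
    using Q by (subst mult_four_block_mat[of _ 1 1 _ m _ m _ _ 1 _ m]) auto
  have KKt: "K * transpose_mat K = 1\<^sub>m ?n"
    unfolding Kt unfolding K_def one_block[symmetric]
    using Q by (subst mult_four_block_mat[of _ 1 1 _ m _ m _ _ 1 _ m]) auto
  have KGK: "transpose_mat K * G * K = four_block_mat L (0\<^sub>m 1 m) (0\<^sub>m m 1) (transpose_mat Q * C * Q)"
    unfolding Kt Gblock unfolding K_def
    using Q C L
    apply (subst mult_four_block_mat[of _ 1 1 _ m _ m _ _ 1 _ m], simp_all)
    apply (subst mult_four_block_mat[of _ 1 1 _ m _ m _ _ 1 _ m], simp_all)
    done
  define R where "R = H * K"
  have Rt: "transpose_mat R = transpose_mat K * H"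
    unfolding R_def using transpose_mult[OF H(1) K] by (simp add: Ht)
  have "transpose_mat R * R = transpose_mat K * (H * H) * K"
    unfolding Rt unfolding R_def using H(1) K
    by (simp del: transpose_carrier_mat add: assoc_mult_mat[of _ ?n ?n _ ?n _ ?n] transpose_carrier_mat[THEN iffD2])
  moreover have "R * transpose_mat R = H * (K * transpose_mat K) * H"
    unfolding Rt unfolding R_def using H(1) K
    by (simp add: assoc_mult_mat[of _ ?n ?n _ ?n _ ?n])
  moreover have "transpose_mat R * B * R = transpose_mat K * G * K"
    unfolding Rt G_def unfolding R_def using H(1) K B
    by (simp add: assoc_mult_mat[of _ ?n ?n _ ?n _ ?n])
  moreover have "\<dots> = mat ?n ?n (\<lambda>(i, j). if i = j then (case i of 0 \<Rightarrow> l | Suc k \<Rightarrow> d k) else 0)"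
    unfolding KGK diag by (rule eq_matI) (auto simp: L_def split: nat.split)
  moreover have "R \<in> carrier_mat ?n ?n" using H K by (simp add: R_def)
  ultimately show ?case
    using KtK KKt H K by (intro exI[of _ R] exI[of _ "case_nat l d"]) (auto simp: H(3))
qed

lemma quadratic_form_diag:
  fixes v :: "real vec"
  assumes "v \<in> carrier_vec n"
  shows "v \<bullet> (mat n n (\<lambda>(i, j). if i = j then d i else 0) *\<^sub>v v) = (\<Sum>i<n. d i * (v $ i)\<^sup>2)"
proof -
  have "(mat n n (\<lambda>(i, j). if i = j then d i else 0) *\<^sub>v v) $ i = d i * v $ i" if "i < n" for i
  proof -
    have "(\<Sum>j<n. (if i = j then d i else 0) * v $ j) = (\<Sum>j<n. if j = i then d i * v $ i else 0)"
      by (intro sum.cong) auto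
    then show ?thesis using that assms by (simp add: scalar_prod_def atLeast0LessThan)
  qed
  then show ?thesis
    using assms by (auto simp: scalar_prod_def atLeast0LessThan power2_eq_square intro!: sum.cong)
qed

text \<open>The last two conclusions give the quadratic form and the squared length in the
  coordinates of the eigenbasis. Positivity of the square root and the Rayleigh bound are both read
  off from them.\<close>

lemma spectral_theorem:
  assumes B: "B \<in> carrier_mat n n" and sym: "sym_mat B"
  obtains Q d where "Q \<in> carrier_mat n n" "transpose_mat Q * Q = 1\<^sub>m n" "Q * transpose_mat Q = 1\<^sub>m n"
    "B = Q * mat n n (\<lambda>(i, j). if i = j then d i else 0) * transpose_mat Q"
    "\<And>i. i < n \<Longrightarrow> eigenvector B (col Q i) (d i)"
    "\<And>v. v \<in> carrier_vec n \<Longrightarrow> v \<bullet> (B *\<^sub>v v) = (\<Sum>i<n. d i * ((transpose_mat Q *\<^sub>v v) $ i)\<^sup>2)"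
    "\<And>v. v \<in> carrier_vec n \<Longrightarrow> v \<bullet> v = (\<Sum>i<n. ((transpose_mat Q *\<^sub>v v) $ i)\<^sup>2)"
proof -
  obtain Q d where Q: "Q \<in> carrier_mat n n" "transpose_mat Q * Q = 1\<^sub>m n" "Q * transpose_mat Q = 1\<^sub>m n"
    and diag: "transpose_mat Q * B * Q = mat n n (\<lambda>(i, j). if i = j then d i else 0)"
    using sym_mat_diagonalize[OF B sym] by blast
  define D where "D = mat n n (\<lambda>(i, j). if i = j then d i else 0)"
  have D: "D \<in> carrier_mat n n" by (simp add: D_def)
  have Qt: "transpose_mat Q \<in> carrier_mat n n" using Q by simp
  have "Q * D * transpose_mat Q = (Q * transpose_mat Q) * B * (Q * transpose_mat Q)"
    unfolding D_def diag[symmetric] using Q(1) B by (simp add: assoc_mult_mat[of _ n n _ n _ n])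
  then have BQ: "B = Q * D * transpose_mat Q" using Q B by simp
  have "B * Q = Q * D"
    unfolding BQ using Q(1,2) D by (simp add: assoc_mult_mat[of _ n n _ n _ n])
  have ev: "eigenvector B (col Q i) (d i)" if i: "i < n" for i
  proof -
    have "B *\<^sub>v col Q i = col (B * Q) i" using i Q B by (intro eq_vecI) auto
    also have "\<dots> = Q *\<^sub>v col D i" using \<open>B * Q = Q * D\<close> i Q D by (intro eq_vecI) auto
    also have "col D i = d i \<cdot>\<^sub>v unit_vec n i"
      using i by (intro eq_vecI) (auto simp: D_def)
    also have "Q *\<^sub>v (d i \<cdot>\<^sub>v unit_vec n i) = d i \<cdot>\<^sub>v col Q i"
      using mult_mat_vec[OF Q(1), of "unit_vec n i" "d i"] i Q(1) by (auto intro!: eq_vecI)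
    finally have "B *\<^sub>v col Q i = d i \<cdot>\<^sub>v col Q i" .
    moreover have "col Q i \<noteq> 0\<^sub>v n"
    proof
      assume "col Q i = 0\<^sub>v n"
      then have "(transpose_mat Q * Q) $$ (i, i) = 0" using i Q(1) by simp
      then show False using Q(2) i by simp
    qed
    ultimately show ?thesis using B Q(1) i by (auto simp: eigenvector_def)
  qed
  have form: "v \<bullet> (Q *\<^sub>v w) = (transpose_mat Q *\<^sub>v v) \<bullet> w"
    if "v \<in> carrier_vec n" "w \<in> carrier_vec n" for v w
    using transpose_vec_mult_scalar[OF Q(1) that(2,1)] by simp
  have "v \<bullet> (B *\<^sub>v v) = (\<Sum>i<n. d i * ((transpose_mat Q *\<^sub>v v) $ i)\<^sup>2)" if v: "v \<in> carrier_vec n" for v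
  proof -
    have Qv: "transpose_mat Q *\<^sub>v v \<in> carrier_vec n" using mult_mat_vec_carrier[OF Qt v] .
    have "B *\<^sub>v v = Q *\<^sub>v (D *\<^sub>v (transpose_mat Q *\<^sub>v v))"
      unfolding BQ using Q(1) D Qv v Qt
      by (simp add: assoc_mult_mat[of _ n n _ n _ n] assoc_mult_mat_vec[of _ n n _ n])
    then show ?thesis
      using form[OF v mult_mat_vec_carrier[OF D Qv]] quadratic_form_diag[OF Qv, of d]
      by (simp add: D_def)
  qed
  moreover have "v \<bullet> v = (\<Sum>i<n. ((transpose_mat Q *\<^sub>v v) $ i)\<^sup>2)" if v: "v \<in> carrier_vec n" for v
  proof -
    have Qv: "transpose_mat Q *\<^sub>v v \<in> carrier_vec n" using mult_mat_vec_carrier[OF Qt v] .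
    have "v = Q *\<^sub>v (transpose_mat Q *\<^sub>v v)"
      using assoc_mult_mat_vec[OF Q(1) Qt v] Q(3) v by simp
    then have "v \<bullet> v = (transpose_mat Q *\<^sub>v v) \<bullet> (transpose_mat Q *\<^sub>v v)"
      using form[OF v Qv] by simp
    then show ?thesis
      using Qv Q(1) by (simp add: scalar_prod_def power2_eq_square atLeast0LessThan)
  qed
  ultimately show thesis using that Q BQ ev unfolding D_def by blast
qed

section \<open>Positive definite matrices: the square root and the Rayleigh bound\<close>

lemma pos_defD:
  assumes "pos_def n B"
  shows "B \<in> carrier_mat n n" "sym_mat B"
    "v \<in> carrier_vec n \<Longrightarrow> v \<noteq> 0\<^sub>v n \<Longrightarrow> 0 < v \<bullet> (B *\<^sub>v v)"
    "v \<in> carrier_vec n \<Longrightarrow> 0 \<le> v \<bullet> (B *\<^sub>v v)"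
proof -
  show *: "B \<in> carrier_mat n n" "sym_mat B"
    "v \<in> carrier_vec n \<Longrightarrow> v \<noteq> 0\<^sub>v n \<Longrightarrow> 0 < v \<bullet> (B *\<^sub>v v)"
    using assms by (auto simp: pos_def_def)
  show "v \<in> carrier_vec n \<Longrightarrow> 0 \<le> v \<bullet> (B *\<^sub>v v)"
    using * by (cases "v = 0\<^sub>v n") auto
qed

lemma pos_def_det:
  assumes "pos_def n B"
  shows "det B \<noteq> 0"
  using det_0_iff_vec_prod_zero[OF pos_defD(1)[OF assms]] pos_defD(3)[OF assms]
  by (metis less_irrefl scalar_prod_right_zero)

text \<open>Taking roots of the eigenvalues in an orthonormal eigenbasis; they are positive since
  \<open>W\<close> is positive at each eigenvector.\<close>

lemma pos_def_sqrt_exists: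
  assumes W: "pos_def n W"
  obtains R where "pos_def n R" "R * R = W"
proof -
  obtain Q d where Q: "Q \<in> carrier_mat n n" "transpose_mat Q * Q = 1\<^sub>m n" "Q * transpose_mat Q = 1\<^sub>m n"
    and WQ: "W = Q * mat n n (\<lambda>(i, j). if i = j then d i else 0) * transpose_mat Q"
    and ev: "\<And>i. i < n \<Longrightarrow> eigenvector W (col Q i) (d i)"
    and sq: "\<And>v. v \<in> carrier_vec n \<Longrightarrow> v \<bullet> v = (\<Sum>i<n. ((transpose_mat Q *\<^sub>v v) $ i)\<^sup>2)"
    by (rule spectral_theorem[OF pos_defD(1,2)[OF W]], rule that; assumption)
  have d: "0 < d i" if "i < n" for i
  proof -
    have v: "col Q i \<in> carrier_vec n" "col Q i \<noteq> 0\<^sub>v n" "W *\<^sub>v col Q i = d i \<cdot>\<^sub>v col Q i"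
      using ev[OF that] pos_defD(1)[OF W] by (auto simp: eigenvector_def)
    have "0 < d i * (col Q i \<bullet> col Q i)"
      using pos_defD(3)[OF W v(1,2)] v by simp
    then show ?thesis
      using scalar_prod_self_pos[OF v(1,2)] by (simp add: zero_less_mult_iff)
  qed
  define D where "D = mat n n (\<lambda>(i, j). if i = j then sqrt (d i) else 0)"
  have D: "D \<in> carrier_mat n n" by (simp add: D_def)
  have DD: "D * D = mat n n (\<lambda>(i, j). if i = j then d i else 0)"
  proof (rule eq_matI)
    fix i j assume "i < dim_row (mat n n (\<lambda>(i, j). if i = j then d i else 0))"
      "j < dim_col (mat n n (\<lambda>(i, j). if i = j then d i else 0))"
    then have ij: "i < n" "j < n" by auto
    have "(D * D) $$ (i, j) = (\<Sum>k<n. (if i = k then sqrt (d i) else 0) * (if k = j then sqrt (d k) else 0))"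
      using ij by (simp add: D_def scalar_prod_def atLeast0LessThan)
    also have "\<dots> = (\<Sum>k<n. if k = i then (if i = j then d i else 0) else 0)"
      using ij d[OF ij(1)] by (intro sum.cong) auto
    finally show "(D * D) $$ (i, j) = mat n n (\<lambda>(i, j). if i = j then d i else 0) $$ (i, j)"
      using ij by simp
  qed (use D in auto)
  have Dt: "transpose_mat D = D" by (auto simp: D_def intro!: eq_matI)
  define R where "R = Q * D * transpose_mat Q"
  have Qt: "transpose_mat Q \<in> carrier_mat n n" using Q by simp
  have R: "R \<in> carrier_mat n n" using Q D by (simp add: R_def)
  have "R * R = Q * (D * (transpose_mat Q * Q) * D) * transpose_mat Q"
    unfolding R_def using Q(1) D by (simp add: assoc_mult_mat[of _ n n _ n _ n])
  then have RR: "R * R = W" using Q(2) D DD WQ by simp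
  have "sym_mat R"
    using sym_mat_congruence[OF D Qt] Dt unfolding R_def by (simp add: sym_mat_def)
  moreover have "0 < v \<bullet> (R *\<^sub>v v)" if v: "v \<in> carrier_vec n" "v \<noteq> 0\<^sub>v n" for v
  proof -
    let ?w = "transpose_mat Q *\<^sub>v v"
    have w: "?w \<in> carrier_vec n" using mult_mat_vec_carrier[OF Qt v(1)] .
    have "R *\<^sub>v v = Q *\<^sub>v (D *\<^sub>v ?w)"
      unfolding R_def using Q(1) D w v Qt
      by (simp add: assoc_mult_mat[of _ n n _ n _ n] assoc_mult_mat_vec[of _ n n _ n])
    then have "v \<bullet> (R *\<^sub>v v) = ?w \<bullet> (D *\<^sub>v ?w)"
      using transpose_vec_mult_scalar[OF Q(1) _ v(1), of "D *\<^sub>v ?w"] D w by simp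
    also have "\<dots> = (\<Sum>i<n. sqrt (d i) * (?w $ i)\<^sup>2)"
      unfolding D_def by (rule quadratic_form_diag[OF w])
    also have "\<dots> > 0"
    proof -
      \<comment> \<open>\<open>transpose_mat Q\<close> preserves length, so a nonzero
        \<open>v\<close> has a nonzero coordinate, and that one summand makes the sum
        positive.\<close>
      have "0 < (\<Sum>i<n. (?w $ i)\<^sup>2)" using sq[OF v(1)] scalar_prod_self_pos[OF v] by simp
      then have "\<not> (\<forall>i<n. ?w $ i = 0)"
        by (metis (no_types, lifting) lessThan_iff less_irrefl sum.neutral zero_power2)
      then obtain i where i: "i < n" "?w $ i \<noteq> 0" by blast
      have "0 < sqrt (d i) * (?w $ i)\<^sup>2" using d[OF i(1)] i(2) by simp
      moreover have "0 \<le> sqrt (d j) * (?w $ j)\<^sup>2" if "j < n" for j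
        using d[OF that] by simp
      ultimately show ?thesis
        using i(1) by (intro sum_pos2[of _ i]) auto
    qed
    finally show ?thesis .
  qed
  ultimately have "pos_def n R" using R by (auto simp: pos_def_def)
  then show thesis using that RR by blast
qed

lemma lambda_min_quadratic_form:
  assumes B: "B \<in> carrier_mat n n" and sym: "sym_mat B" and v: "v \<in> carrier_vec n"
  shows "lambda_min B * (v \<bullet> v) \<le> v \<bullet> (B *\<^sub>v v)"
proof -
  obtain Q d where ev: "\<And>i. i < n \<Longrightarrow> eigenvector B (col Q i) (d i)"
    and "\<And>v. v \<in> carrier_vec n \<Longrightarrow> v \<bullet> (B *\<^sub>v v) = (\<Sum>i<n. d i * ((transpose_mat Q *\<^sub>v v) $ i)\<^sup>2)"
    and "\<And>v. v \<in> carrier_vec n \<Longrightarrow> v \<bullet> v = (\<Sum>i<n. ((transpose_mat Q *\<^sub>v v) $ i)\<^sup>2)"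
    by (rule spectral_theorem[OF B sym], rule that; assumption)
  note form = this(2)[OF v] and sq = this(3)[OF v]
  \<comment> \<open>\<open>Min\<close> is informative only on a finite set; the eigenvalues are the
    roots of a nonzero polynomial.\<close>
  have "char_poly B \<noteq> 0" using degree_monic_char_poly[OF B] by auto
  then have "finite {l. eigenvalue B l}"
    using poly_roots_finite[of "char_poly B"] by (simp add: eigenvalue_root_char_poly[OF B])
  then have "lambda_min B \<le> d i" if "i < n" for i
    using ev[OF that] unfolding lambda_min_def by (intro Min_le) (auto simp: eigenvalue_def[abs_def])
  then show ?thesis
    unfolding form sq sum_distrib_left by (intro sum_mono mult_right_mono) auto
qed

subsection \<open>Traces and the square root\<close>

lemma mat_trace_comm:
  assumes "A \<in> carrier_mat n m" "B \<in> carrier_mat m n"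
  shows "mat_trace (A * B) = mat_trace (B * A)"
proof -
  have "mat_trace (A * B) = (\<Sum>i<n. \<Sum>j<m. A $$ (i, j) * B $$ (j, i))"
    using assms by (simp add: mat_trace_def scalar_prod_def atLeast0LessThan)
  also have "\<dots> = (\<Sum>j<m. \<Sum>i<n. B $$ (j, i) * A $$ (i, j))"
    by (subst sum.swap) (simp add: mult.commute)
  also have "\<dots> = mat_trace (B * A)"
    using assms by (simp add: mat_trace_def scalar_prod_def atLeast0LessThan)
  finally show ?thesis .
qed

lemma mat_trace_minus:
  assumes "A \<in> carrier_mat n n" "B \<in> carrier_mat n n"
  shows "mat_trace (A - B) = mat_trace A - mat_trace B"
  using assms by (simp add: mat_trace_def sum_subtractf)

lemma mat_trace_add:
  assumes "A \<in> carrier_mat n n" "B \<in> carrier_mat n n"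
  shows "mat_trace (A + B) = mat_trace A + mat_trace B"
  using assms by (simp add: mat_trace_def sum.distrib)

lemma mat_trace_smult:
  assumes "A \<in> carrier_mat n n"
  shows "mat_trace (c \<cdot>\<^sub>m A) = c * mat_trace A"
  using assms by (simp add: mat_trace_def sum_distrib_left)

lemma mat_trace_mult_sum:
  assumes "A \<in> carrier_mat n m" "B \<in> carrier_mat m n"
  shows "mat_trace (A * B) = (\<Sum>i<n. \<Sum>j<m. A $$ (i, j) * B $$ (j, i))"
  using assms by (simp add: mat_trace_def scalar_prod_def atLeast0LessThan)

text \<open>The bridge from vectors to matrices: an inequality between quadratic forms becomes one
  between traces by summing over the columns of \<open>E\<close>.\<close>

lemma mat_trace_congruence:
  assumes M: "M \<in> carrier_mat n n" and E: "E \<in> carrier_mat n m"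
  shows "mat_trace (transpose_mat E * M * E) = (\<Sum>j<m. col E j \<bullet> (M *\<^sub>v col E j))"
proof -
  have "transpose_mat E * M * E = transpose_mat E * (M * E)"
    using assms by (intro assoc_mult_mat[of _ m n _ n]) auto
  moreover have "col (M * E) j = M *\<^sub>v col E j" if "j < m" for j
    using that assms by (intro eq_vecI) auto
  ultimately show ?thesis using assms by (simp add: mat_trace_def)
qed

lemma mat_trace_congruence_nonneg:
  assumes M: "M \<in> carrier_mat n n" and psd: "\<And>v. v \<in> carrier_vec n \<Longrightarrow> 0 \<le> v \<bullet> (M *\<^sub>v v)"
    and E: "E \<in> carrier_mat n m"
  shows "0 \<le> mat_trace (transpose_mat E * M * E)"
  unfolding mat_trace_congruence[OF M E] using E by (auto intro!: sum_nonneg psd)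

text \<open>By cyclicity the trace is that of the congruence of \<open>M\<close> by
  \<open>E K\<close>. It is applied with \<open>K\<close> the symmetric root of \<open>V\<close>,
  and also with a Gram factor of \<open>Z\<close>.\<close>

lemma mat_trace_weighted_nonneg:
  assumes M: "M \<in> carrier_mat n n" and psd: "\<And>v. v \<in> carrier_vec n \<Longrightarrow> 0 \<le> v \<bullet> (M *\<^sub>v v)"
    and E: "E \<in> carrier_mat n n" and K: "K \<in> carrier_mat n n"
  shows "0 \<le> mat_trace (transpose_mat E * M * E * (K * transpose_mat K))"
proof -
  have "mat_trace (transpose_mat E * M * E * (K * transpose_mat K))
      = mat_trace ((transpose_mat E * M * E * K) * transpose_mat K)"
    using M E K by (simp add: assoc_mult_mat[of _ n n _ n _ n])
  also have "\<dots> = mat_trace (transpose_mat K * (transpose_mat E * M * E * K))"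
    using M E K by (intro mat_trace_comm[of _ n n]) auto
  also have "\<dots> = mat_trace (transpose_mat (E * K) * M * (E * K))"
    using M E K by (simp add: transpose_mult[OF E K] assoc_mult_mat[of _ n n _ n _ n])
  also have "\<dots> \<ge> 0"
    using E K by (intro mat_trace_congruence_nonneg[OF M psd]) auto
  finally show ?thesis .
qed

lemma pos_def_sqrt_unique:
  assumes R: "pos_def n R" and R': "pos_def n R'" and eq: "R * R = R' * R'"
  shows "R = R'"
proof -
  \<comment> \<open>\<open>D\<close> satisfies \<open>R D + D R' = 0\<close>; the trace of \<open>D (R D + D R')\<close> is a sum of two nonnegative terms.\<close>
  define D where "D = R - R'"
  note c = pos_defD(1)[OF R] pos_defD(1)[OF R']
  have D: "D \<in> carrier_mat n n" using c by (simp add: D_def minus_carrier_mat)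
  have Dt: "transpose_mat D = D"
    using pos_defD(2)[OF R] pos_defD(2)[OF R'] transpose_minus[OF c] by (simp add: D_def sym_mat_def)
  have eq0: "R * D + D * R' = 0\<^sub>m n n"
    using c eq unfolding D_def
    by (auto simp: mult_minus_distrib_mat[of _ n n _ n] minus_mult_distrib_mat[of _ n n _ _ n] intro!: eq_matI)
  have "mat_trace (transpose_mat D * R * D) + mat_trace (transpose_mat D * R' * D)
      = mat_trace (D * (R * D)) + mat_trace ((D * R') * D)"
    unfolding Dt using c D by (simp add: assoc_mult_mat[of _ n n _ n _ n])
  also have "mat_trace ((D * R') * D) = mat_trace (D * (D * R'))"
    using c D by (intro mat_trace_comm[of _ n n]) auto
  also have "mat_trace (D * (R * D)) + \<dots> = mat_trace (D * (R * D + D * R'))"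
    using c D by (simp add: mult_add_distrib_mat[of _ n n _ n] mat_trace_add[of _ n])
  also have "\<dots> = 0" using D unfolding eq0 by (simp add: mat_trace_def)
  finally have "mat_trace (transpose_mat D * R * D) = 0"
    using mat_trace_congruence_nonneg[OF c(1) pos_defD(4)[OF R] D]
      mat_trace_congruence_nonneg[OF c(2) pos_defD(4)[OF R'] D] by simp
  then have "(\<Sum>j<n. col D j \<bullet> (R *\<^sub>v col D j)) = 0"
    using mat_trace_congruence[OF c(1) D] by simp
  then have "\<forall>j<n. col D j \<bullet> (R *\<^sub>v col D j) = 0"
    using pos_defD(4)[OF R] D by (subst (asm) sum_nonneg_eq_0_iff) auto
  then have "col D j = 0\<^sub>v n" if "j < n" for j
    using pos_defD(3)[OF R, of "col D j"] D that by fastforce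
  then have "D $$ (i, j) = 0" if "i < n" "j < n" for i j
    using that D by (metis carrier_matD index_col index_zero_vec(1))
  then show ?thesis
    using c by (intro eq_matI) (auto simp: D_def)
qed

lemma mat_sqrt:
  assumes "pos_def n W"
  shows "pos_def n (mat_sqrt n W)" "mat_sqrt n W * mat_sqrt n W = W"
proof -
  obtain R where R: "pos_def n R \<and> R * R = W" using pos_def_sqrt_exists[OF assms] by blast
  have "pos_def n (mat_sqrt n W) \<and> mat_sqrt n W * mat_sqrt n W = W"
    unfolding mat_sqrt_def
    by (rule theI[of _ R]) (use R pos_def_sqrt_unique in auto)
  then show "pos_def n (mat_sqrt n W)" "mat_sqrt n W * mat_sqrt n W = W" by auto
qed

lemma minus_mat_right_cancel:
  fixes M N B :: "'a :: group_add mat"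
  assumes "M \<in> carrier_mat nr nc" "N \<in> carrier_mat nr nc" "B \<in> carrier_mat nr nc" "M - B = N - B"
  shows "M = N"
proof (rule eq_matI)
  fix i j assume "i < dim_row N" "j < dim_col N"
  then have "M $$ (i, j) - B $$ (i, j) = N $$ (i, j) - B $$ (i, j)"
    using arg_cong[OF assms(4), of "\<lambda>M. M $$ (i, j)"] assms(1-3) by simp
  then show "M $$ (i, j) = N $$ (i, j)" by (metis diff_add_cancel)
qed (use assms in auto)

subsection \<open>Sketched projections\<close>

locale sketch_setting =
  fixes n :: nat and A W :: "real mat"
  assumes A: "A \<in> carrier_mat n n" "invertible_mat A"
    and W: "pos_def n W"
begin

abbreviation "V \<equiv> mat_inv W"
abbreviation "B \<equiv> mat_inv A"
abbreviation "Z \<equiv> sketch_Z A W"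
text \<open>The squared weighted norm without the root. It is a polynomial in the entries of
  \<open>E\<close>, the form in which measurability and expectations are handled.\<close>

abbreviation "err E \<equiv> mat_trace (transpose_mat E * V * E * V)"

lemmas assoc = assoc_mult_mat[of _ n n _ n _ n]

lemma W_carrier: "W \<in> carrier_mat n n" by (rule pos_defD(1)[OF W])

lemma W_transpose [simp]: "transpose_mat W = W"
  using pos_defD(2)[OF W] by (simp add: sym_mat_def)

lemma A_carrier: "A \<in> carrier_mat n n" by (rule A)

lemma B_carrier: "B \<in> carrier_mat n n" by (rule mat_inv_carrier[OF A(1)])

lemma A_mult_B [simp]: "A * B = 1\<^sub>m n" and B_mult_A [simp]: "B * A = 1\<^sub>m n"
proof -
  obtain C where C: "A * C = 1\<^sub>m (dim_row A)" "C * A = 1\<^sub>m (dim_row C)"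
    using A(2) by (auto simp: invertible_mat_def inverts_mat_def)
  then have "C \<in> carrier_mat n n" using C A(1)
    by (metis carrier_matD carrier_matI index_mult_mat(3) index_one_mat(3))
  then have "det A * det C = 1" using det_mult[OF A(1)] C(1) A(1) by fastforce
  then have "det A \<noteq> 0" by auto
  then show "A * B = 1\<^sub>m n" "B * A = 1\<^sub>m n" using mat_inv[OF A(1)] by auto
qed

lemma V_carrier: "V \<in> carrier_mat n n" by (rule mat_inv_carrier[OF W_carrier])

lemma W_mult_V [simp]: "W * V = 1\<^sub>m n" and V_mult_W [simp]: "V * W = 1\<^sub>m n"
  using mat_inv[OF W_carrier pos_def_det[OF W]] by auto

lemma V_transpose [simp]: "transpose_mat V = V"
  using sym_mat_mat_inv[OF W_carrier] by (simp add: sym_mat_def)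

text \<open>\<open>K\<close> is the inverse of the square root of \<open>W\<close>, and thus a
  symmetric square root of \<open>V\<close>. The substitution \<open>y = K v\<close> translates
  between the form of \<open>V\<close> and the Euclidean one.\<close>

lemma V_factor:
  obtains K where "K \<in> carrier_mat n n" "transpose_mat K = K" "K * mat_sqrt n W = 1\<^sub>m n"
    "mat_sqrt n W * K = 1\<^sub>m n" "V = K * K"
proof -
  let ?R = "mat_sqrt n W"
  note R = mat_sqrt[OF W]
  note c = pos_defD(1)[OF R(1)]
  note inv = mat_inv[OF c pos_def_det[OF R(1)]]
  have "W * (mat_inv ?R * mat_inv ?R) = ?R * (?R * mat_inv ?R) * mat_inv ?R"
    using inv(1) c by (subst R(2)[symmetric]) (simp add: assoc del: R(2))
  then have "V = mat_inv ?R * mat_inv ?R"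
    using inv c by (intro mat_inv_eqI[OF W_carrier]) auto
  moreover have "transpose_mat (mat_inv ?R) = mat_inv ?R"
    using sym_mat_mat_inv[OF c pos_defD(2)[OF R(1)]] by (simp add: sym_mat_def)
  ultimately show thesis using that inv by blast
qed

lemma V_psd:
  assumes v: "v \<in> carrier_vec n"
  shows "0 \<le> v \<bullet> (V *\<^sub>v v)"
proof -
  obtain K where K: "K \<in> carrier_mat n n" "transpose_mat K = K" "V = K * K" using V_factor by metis
  have "v \<bullet> (V *\<^sub>v v) = (K *\<^sub>v v) \<bullet> (K *\<^sub>v v)"
    using transpose_vec_mult_scalar[OF K(1) mult_mat_vec_carrier[OF K(1) v] v] v K by simp
  then show ?thesis using scalar_prod_self_nonneg by simp
qed

lemma mat_trace_V_nonneg: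
  assumes "M \<in> carrier_mat n n" "\<And>v. v \<in> carrier_vec n \<Longrightarrow> 0 \<le> v \<bullet> (M *\<^sub>v v)" "E \<in> carrier_mat n n"
  shows "0 \<le> mat_trace (transpose_mat E * M * E * V)"
proof -
  obtain K where K: "K \<in> carrier_mat n n" "transpose_mat K = K" "V = K * K" using V_factor by metis
  show ?thesis using mat_trace_weighted_nonneg[OF assms K(1)] K by simp
qed

lemma err_nonneg: "E \<in> carrier_mat n n \<Longrightarrow> 0 \<le> err E"
  by (intro mat_trace_V_nonneg V_psd V_carrier)

lemma weighted_frob_norm_power2: "E \<in> carrier_mat n n \<Longrightarrow> (weighted_frob_norm V E)\<^sup>2 = err E"
  using err_nonneg by (simp add: weighted_frob_norm_def)

text \<open>\<open>err I\<close> is the sum of the squared lengths of the columns of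
  \<open>V\<close>, and \<open>W V = I\<close> forbids a zero column. The strict sign allows
  division by \<open>err I\<close> when \<rho> is shown to be nonnegative.\<close>

lemma err_one_pos:
  assumes "0 < n"
  shows "0 < err (1\<^sub>m n)"
proof -
  have "err (1\<^sub>m n) = mat_trace (transpose_mat V * 1\<^sub>m n * V)"
    using V_carrier by simp
  also have "\<dots> = (\<Sum>j<n. col V j \<bullet> col V j)"
    using V_carrier by (subst mat_trace_congruence[of _ n _ n]) auto
  finally have *: "err (1\<^sub>m n) = (\<Sum>j<n. col V j \<bullet> col V j)" .
  have "col V 0 \<noteq> 0\<^sub>v n"
  proof
    assume "col V 0 = 0\<^sub>v n"
    moreover have "(W * V) $$ (0, 0) = row W 0 \<bullet> col V 0"
      using assms W_carrier V_carrier by (intro index_mult_mat) auto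
    ultimately show False using assms by (simp add: row_carrier_vec[OF _ W_carrier])
  qed
  then have "0 < col V 0 \<bullet> col V 0"
    using scalar_prod_self_pos[OF col_carrier_vec[OF assms V_carrier]] by simp
  then show ?thesis
    unfolding * using assms by (intro sum_pos2[of _ 0]) (auto intro: scalar_prod_self_nonneg)
qed

text \<open>Let \<open>l\<close> be the smallest eigenvalue on the left. The Rayleigh bound at
  \<open>y = W^(-1/2) v\<close> says that \<open>M - l V\<close> is positive semidefinite, and the
  trace of its congruence by \<open>E\<close>, weighted by \<open>V\<close>, is then
  nonnegative.\<close>

lemma lambda_min_err:
  assumes M: "M \<in> carrier_mat n n" "sym_mat M" and E: "E \<in> carrier_mat n n"
  shows "lambda_min (mat_sqrt n W * M * mat_sqrt n W) * err E \<le> mat_trace (transpose_mat E * M * E * V)"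
proof -
  let ?R = "mat_sqrt n W"
  let ?l = "lambda_min (?R * M * ?R)"
  have R: "?R \<in> carrier_mat n n" "transpose_mat ?R = ?R"
    using pos_defD[OF mat_sqrt(1)[OF W]] by (auto simp: sym_mat_def)
  obtain K where K: "K \<in> carrier_mat n n" "transpose_mat K = K" "K * ?R = 1\<^sub>m n"
    "?R * K = 1\<^sub>m n" "V = K * K"
    using V_factor by metis
  define N where "N = M - ?l \<cdot>\<^sub>m V"
  have N: "N \<in> carrier_mat n n" using M V_carrier by (simp add: N_def minus_carrier_mat)
  have "0 \<le> v \<bullet> (N *\<^sub>v v)" if v: "v \<in> carrier_vec n" for v
  proof -
    define y where "y = K *\<^sub>v v"
    have y: "y \<in> carrier_vec n" using K(1) v by (simp add: y_def)
    have vy: "v = ?R *\<^sub>v y"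
      using assoc_mult_mat_vec[OF R(1) K(1) v] K v by (simp add: y_def)
    have "sym_mat (?R * M * ?R)"
      using sym_mat_congruence[OF M(1) R(1) M(2)] R by simp
    then have "?l * (y \<bullet> y) \<le> y \<bullet> ((?R * M * ?R) *\<^sub>v y)"
      using R(1) M(1) by (intro lambda_min_quadratic_form[of _ n] y) auto
    also have "(?R * M * ?R) *\<^sub>v y = ?R *\<^sub>v (M *\<^sub>v v)"
      unfolding vy using R(1) M(1) y by (simp add: assoc assoc_mult_mat_vec[of _ n n _ n])
    also have "y \<bullet> (?R *\<^sub>v (M *\<^sub>v v)) = v \<bullet> (M *\<^sub>v v)"
      using transpose_vec_mult_scalar[OF R(1) mult_mat_vec_carrier[OF M(1) v] y] R(2) vy by simp
    also have "y \<bullet> y = v \<bullet> (V *\<^sub>v v)"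
      using transpose_vec_mult_scalar[OF K(1) y v] v K by (simp add: y_def)
    finally have "?l * (v \<bullet> (V *\<^sub>v v)) \<le> v \<bullet> (M *\<^sub>v v)" .
    moreover have "N *\<^sub>v v = M *\<^sub>v v - ?l \<cdot>\<^sub>v (V *\<^sub>v v)"
    proof -
      have "(?l \<cdot>\<^sub>m V) *\<^sub>v v = ?l \<cdot>\<^sub>v (V *\<^sub>v v)"
        using v V_carrier by (intro eq_vecI) (auto simp: smult_scalar_prod_distrib[of _ n])
      then show ?thesis
        unfolding N_def using v M(1) V_carrier by (subst minus_mult_distrib_mat_vec[of _ n n]) auto
    qed
    ultimately show ?thesis
      using v M(1) mult_mat_vec_carrier[OF V_carrier v] mult_mat_vec_carrier[OF M(1) v]
      by (simp add: scalar_prod_minus_distrib[of _ n])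
  qed
  then have "0 \<le> mat_trace (transpose_mat E * N * E * V)"
    by (rule mat_trace_V_nonneg[OF N _ E])
  also have "transpose_mat E * N * E * V
      = transpose_mat E * M * E * V - ?l \<cdot>\<^sub>m (transpose_mat E * V * E * V)"
  proof -
    have "transpose_mat E * N = transpose_mat E * M - ?l \<cdot>\<^sub>m (transpose_mat E * V)"
      unfolding N_def using E M(1) V_carrier
      by (simp add: mult_minus_distrib_mat[of _ n n _ n] mult_smult_distrib[of _ n n _ n])
    then show ?thesis
      using E M(1) V_carrier
      by (simp add: minus_mult_distrib_mat[of _ n n _ _ n] mult_smult_assoc_mat[of _ n n _ n])
  qed
  finally have "0 \<le> mat_trace (transpose_mat E * M * E * V - ?l \<cdot>\<^sub>m (transpose_mat E * V * E * V))" .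
  moreover have c: "transpose_mat E * M * E * V \<in> carrier_mat n n" "transpose_mat E * V * E * V \<in> carrier_mat n n"
    using E M(1) V_carrier by auto
  ultimately show ?thesis
    using mat_trace_minus[OF c(1), of "?l \<cdot>\<^sub>m _"] mat_trace_smult[OF c(2)] c(2) by fastforce
qed

section \<open>The matrix \<open>Z\<close> of a single sketch\<close>

lemmas carriers = A_carrier B_carrier W_carrier V_carrier

text \<open>\<open>A\<close> and \<open>S\<close> enter \<open>Z\<close> only through
  \<open>T = A^T S\<close>. In terms of \<open>T\<close> the symmetry of the Gram matrix and of
  \<open>Z\<close> is visible, and the differently bracketed products in the algorithms get a common
  form.\<close>

lemma sketch_factor:
  assumes S: "S \<in> carrier_mat n q"
  defines "T \<equiv> transpose_mat A * S"
  shows "Z S = T * mat_inv (transpose_mat T * W * T) * transpose_mat T"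
    and "transpose_mat S * A * W * transpose_mat A * S = transpose_mat T * W * T"
    and "transpose_mat T = transpose_mat S * A"
proof -
  have At: "transpose_mat A \<in> carrier_mat n n" using carriers by simp
  have St: "transpose_mat S \<in> carrier_mat q n" using S by simp
  show T: "transpose_mat T = transpose_mat S * A"
    unfolding T_def using transpose_mult[OF At S] by simp
  show N: "transpose_mat S * A * W * transpose_mat A * S = transpose_mat T * W * T"
    unfolding T unfolding T_def using carriers S At St
    by (simp add: assoc_mult_mat[of _ q n _ n _ n] assoc_mult_mat[of _ q n _ n _ q]
        assoc_mult_mat[of _ n n _ n _ q] assoc)
  have G: "mat_inv (transpose_mat T * W * T) \<in> carrier_mat q q"
    using carriers S At St unfolding T unfolding T_def by (intro mat_inv_carrier) auto
  show "Z S = T * mat_inv (transpose_mat T * W * T) * transpose_mat T"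
  proof -
    have "T \<in> carrier_mat n q" using S At by (simp add: T_def)
    then show ?thesis
      unfolding sketch_Z_def N using G carriers S At St
      by (simp add: T T_def[symmetric] assoc_mult_mat[of _ n q _ n _ n] assoc_mult_mat[of _ n q _ q _ n])
  qed
qed

text \<open>If the Gram matrix of the sketch is singular, \<open>mat_inv\<close> yields \<open>0\<close>, and hence \<open>Z S = 0\<close>.\<close>
lemma sketch_Z:
  assumes S: "S \<in> carrier_mat n q"
  shows sketch_Z_carrier: "Z S \<in> carrier_mat n n"
    and sketch_Z_transpose: "transpose_mat (Z S) = Z S"
    and sketch_Z_W_sketch_Z: "Z S * W * Z S = Z S"
proof -
  define T where "T = transpose_mat A * S"
  define N where "N = transpose_mat T * W * T"
  define G where "G = mat_inv N"
  have T: "T \<in> carrier_mat n q" "transpose_mat T \<in> carrier_mat q n"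
    using S carriers by (auto simp: T_def)
  have N: "N \<in> carrier_mat q q" using T carriers by (simp add: N_def)
  have "sym_mat N"
    unfolding N_def by (rule sym_mat_congruence[OF W_carrier T(1)]) (simp add: sym_mat_def)
  then have Gt: "transpose_mat G = G" using sym_mat_mat_inv[OF N] by (simp add: G_def sym_mat_def)
  have G: "G \<in> carrier_mat q q" using mat_inv_carrier[OF N] by (simp add: G_def)
  have Z: "Z S = T * G * transpose_mat T"
    using sketch_factor(1)[OF S] by (simp add: T_def N_def G_def)
  show "Z S \<in> carrier_mat n n" unfolding Z using T G by simp
  show "transpose_mat (Z S) = Z S"
    unfolding Z using T G
    by (simp add: transpose_mult[of T n q _ n] transpose_mult[of G q q _ n] Gt)
  have GNG: "G * N * G = G"
  proof (cases "det N = 0")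
    case True
    then have "G = 0\<^sub>m q q" using mat_inv_singular[OF N] by (simp add: G_def)
    then show ?thesis using N by simp
  next
    case False
    then show ?thesis using mat_inv[OF N] G by (simp add: G_def)
  qed
  have "Z S * W * Z S = T * (G * N * G) * transpose_mat T"
  proof -
    have "Z S * W * Z S = T * (G * (transpose_mat T * (W * (T * (G * transpose_mat T)))))"
      unfolding Z using T G carriers
      by (simp add: assoc_mult_mat[of _ n q _ q _ n] assoc_mult_mat[of _ n q _ n _ n]
          assoc_mult_mat[of _ q q _ n _ n] assoc_mult_mat[of _ q n _ n _ n] assoc_mult_mat[of _ n n _ n _ n])
    also have "\<dots> = T * (G * N * G) * transpose_mat T"
      unfolding N_def using T G carriers
      by (simp add: assoc_mult_mat[of _ n q _ q _ n] assoc_mult_mat[of _ q q _ q _ q] assoc_mult_mat[of _ q q _ q _ n]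
          assoc_mult_mat[of _ q n _ n _ q] assoc_mult_mat[of _ n q _ q _ n] assoc_mult_mat[of _ q n _ n _ n]
          assoc_mult_mat[of _ q n _ q _ q] assoc_mult_mat[of _ n n _ q _ q] assoc_mult_mat[of _ n q _ q _ q]
          assoc_mult_mat[of _ q n _ q _ n] assoc_mult_mat[of _ n n _ q _ n])
    finally show ?thesis .
  qed
  then show "Z S * W * Z S = Z S" unfolding GNG using Z by simp
qed

text \<open>From \<open>Z W V = Z\<close> one gets \<open>C^T V = V - Z\<close>. A further factor
  \<open>C\<close> changes nothing, because \<open>V W Z\<close> and \<open>Z W Z\<close> both equal
  \<open>Z\<close> and cancel. The congruence also shows that \<open>V - Z\<close> is positive
  semidefinite, which bounds \<open>Z\<close>.\<close>

lemma sketch_projection: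
  assumes S: "S \<in> carrier_mat n q"
  defines "C \<equiv> 1\<^sub>m n - W * Z S"
  shows "C \<in> carrier_mat n n" "transpose_mat C = 1\<^sub>m n - Z S * W" "transpose_mat C * V * C = V - Z S"
proof -
  note Z = sketch_Z[OF S]
  show C: "C \<in> carrier_mat n n" using Z(1) carriers by (simp add: C_def minus_carrier_mat)
  show Ct: "transpose_mat C = 1\<^sub>m n - Z S * W"
    unfolding C_def using Z carriers
    by (subst transpose_minus[of _ n n]) (auto simp: transpose_mult[of _ n n _ n])
  have "transpose_mat C * V = V - Z S"
    unfolding Ct using Z carriers
    by (simp add: minus_mult_distrib_mat[of _ n n _ _ n] assoc)
  then have "transpose_mat C * V * C = (V - Z S) * (1\<^sub>m n - W * Z S)" by (simp add: C_def)
  also have "\<dots> = (V - Z S) - (V * (W * Z S) - Z S * (W * Z S))"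
    using Z carriers
    by (simp add: mult_minus_distrib_mat[of _ n n _ n] minus_mult_distrib_mat[of _ n n _ _ n] minus_carrier_mat del: assoc_mult_mat)
  also have "V * (W * Z S) = Z S"
    using Z carriers assoc_mult_mat[OF V_carrier W_carrier Z(1)] by simp
  also have "Z S * (W * Z S) = Z S"
    using Z carriers assoc_mult_mat[OF Z(1) W_carrier Z(1)] by simp
  finally show "transpose_mat C * V * C = V - Z S" using Z carriers by (auto intro!: eq_matI)
qed

text \<open>Split the \<open>W\<close> in \<open>Z = Z W Z\<close> into its two square roots and use
  the symmetry of \<open>Z\<close>: the factor is \<open>Z W^(1/2)\<close>.\<close>

lemma sketch_Z_gram:
  assumes S: "S \<in> carrier_mat n q"
  obtains Y where "Y \<in> carrier_mat n n" "Z S = Y * transpose_mat Y"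
proof -
  note Z = sketch_Z[OF S]
  let ?R = "mat_sqrt n W"
  have R: "?R \<in> carrier_mat n n" "transpose_mat ?R = ?R" "?R * ?R = W"
    using pos_defD[OF mat_sqrt(1)[OF W]] mat_sqrt(2)[OF W] by (auto simp: sym_mat_def)
  have "Z S = Z S * (?R * ?R) * Z S" using R(3) Z(3) by simp
  also have "\<dots> = (Z S * ?R) * transpose_mat (Z S * ?R)"
    using R(1) Z(1) by (simp add: transpose_mult[OF Z(1) R(1)] R(2) Z(2) assoc)
  finally show thesis using that[of "Z S * ?R"] Z(1) R(1) by simp
qed

text \<open>\<open>Z\<close> and \<open>V - Z\<close> are positive semidefinite, so each diagonal
  entry of \<open>Z\<close> lies between \<open>0\<close> and that of \<open>V\<close>; the Gram
  factor then controls the other entries by the diagonal ones. The bound mentions neither the sketch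
  nor its number of columns and is the source of all integrability.\<close>

lemma sketch_Z_entry_bound:
  assumes S: "S \<in> carrier_mat n q" and ij: "i < n" "j < n"
  shows "\<bar>Z S $$ (i, j)\<bar> \<le> V $$ (i, i) + V $$ (j, j)"
proof -
  note Z = sketch_Z[OF S] and proj = sketch_projection[OF S]
  obtain Y where Y: "Y \<in> carrier_mat n n" "Z S = Y * transpose_mat Y" using sketch_Z_gram[OF S] .
  have entry: "Z S $$ (a, b) = (\<Sum>k<n. Y $$ (a, k) * Y $$ (b, k))" if "a < n" "b < n" for a b
    using that Y by (simp add: scalar_prod_def atLeast0LessThan)
  have diag: "0 \<le> Z S $$ (a, a)" "Z S $$ (a, a) \<le> V $$ (a, a)" if a: "a < n" for a
  proof -
    show "0 \<le> Z S $$ (a, a)" unfolding entry[OF a a] by (intro sum_nonneg) simp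
    let ?C = "1\<^sub>m n - W * Z S"
    \<comment> \<open>With this bracketing the diagonal entry \<open>a\<close> of
      \<open>V - Z\<close> is the quadratic form of \<open>V\<close> at column \<open>a\<close> of
      the projection.\<close>
    have "transpose_mat ?C * V * ?C = transpose_mat ?C * (V * ?C)"
      using proj(1) V_carrier by (intro assoc_mult_mat[of _ n n _ n _ n]) auto
    then have "(V - Z S) $$ (a, a) = col ?C a \<bullet> col (V * ?C) a"
      using a proj(1) V_carrier unfolding proj(3)[symmetric]
      by (simp del: assoc_mult_mat index_minus_mat)
    also have "col (V * ?C) a = V *\<^sub>v col ?C a"
      using a proj(1) V_carrier by (intro eq_vecI) (auto simp del: index_minus_mat)
    finally have "0 \<le> (V - Z S) $$ (a, a)"
      using V_psd[OF col_carrier_vec[OF a proj(1)]] by simp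
    then show "Z S $$ (a, a) \<le> V $$ (a, a)" using a Z(1) by simp
  qed
  have "\<bar>x * y\<bar> \<le> x * x + y * y" for x y :: real
    using sum_squares_bound[of "\<bar>x\<bar>" "\<bar>y\<bar>"] mult_nonneg_nonneg[of "\<bar>x\<bar>" "\<bar>y\<bar>"]
    unfolding abs_mult power2_eq_square abs_mult_self_eq by linarith
  then have "\<bar>Z S $$ (i, j)\<bar> \<le> (\<Sum>k<n. Y $$ (i, k) * Y $$ (i, k) + Y $$ (j, k) * Y $$ (j, k))"
    unfolding entry[OF ij] by (intro order.trans[OF sum_abs] sum_mono)
  also have "\<dots> = Z S $$ (i, i) + Z S $$ (j, j)" using ij by (simp add: entry sum.distrib)
  also have "\<dots> \<le> V $$ (i, i) + V $$ (j, j)" by (intro add_mono diag ij)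
  finally show ?thesis .
qed

text \<open>The left factor is absorbed by \<open>C^T V C = V - Z\<close>. For the right factor,
  cyclicity of the trace carries \<open>C\<close> around, so that the same identity applies there to
  \<open>F = C E\<close>; it removes a further \<open>Tr (F^T V F Z)\<close>, which is nonnegative
  by the Gram factorization of \<open>Z\<close>.\<close>

lemma err_projection:
  assumes S: "S \<in> carrier_mat n q" and E: "E \<in> carrier_mat n n"
  shows "err ((1\<^sub>m n - W * Z S) * E) = err E - mat_trace (transpose_mat E * Z S * E * V)"
    and "err ((1\<^sub>m n - W * Z S) * E * (1\<^sub>m n - Z S * W)) \<le> err E - mat_trace (transpose_mat E * Z S * E * V)"
proof -
  note Z = sketch_Z[OF S]
  define C where "C = 1\<^sub>m n - W * Z S"
  have C: "C \<in> carrier_mat n n" using Z(1) carriers by (simp add: C_def minus_carrier_mat)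
  note Ct = sketch_projection(2)[OF S, folded C_def] and CVC = sketch_projection(3)[OF S, folded C_def]
  have Et: "transpose_mat E \<in> carrier_mat n n" using E by simp
  have 1: "err (C * E) = mat_trace (transpose_mat E * (transpose_mat C * V * C) * E * V)"
    using C E carriers by (simp add: transpose_mult[OF C E] assoc)
  have "transpose_mat E * (V - Z S) * E * V
      = transpose_mat E * V * E * V - transpose_mat E * Z S * E * V"
  proof -
    have c: "transpose_mat E * V \<in> carrier_mat n n" "transpose_mat E * Z S \<in> carrier_mat n n"
      using Et Z carriers by auto
    show ?thesis
      unfolding mult_minus_distrib_mat[OF Et V_carrier Z(1)] minus_mult_distrib_mat[OF c E]
      by (rule minus_mult_distrib_mat[OF mult_carrier_mat[OF c(1) E] mult_carrier_mat[OF c(2) E] V_carrier])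
  qed
  then have 2: "err (C * E) = err E - mat_trace (transpose_mat E * Z S * E * V)"
  proof -
    have "transpose_mat E * V * E * V \<in> carrier_mat n n" "transpose_mat E * Z S * E * V \<in> carrier_mat n n"
      using E carriers Z by auto
    then show ?thesis using mat_trace_minus \<open>transpose_mat E * (V - Z S) * E * V = _\<close> 1 CVC by metis
  qed
  then show "err ((1\<^sub>m n - W * Z S) * E) = err E - mat_trace (transpose_mat E * Z S * E * V)"
    by (simp add: C_def)
  define F where "F = C * E"
  have F: "F \<in> carrier_mat n n" "transpose_mat F \<in> carrier_mat n n" using C E by (auto simp: F_def)
  have c: "C \<in> carrier_mat n n" "transpose_mat C \<in> carrier_mat n n" using C by auto
  have "err (F * transpose_mat C) = mat_trace (C * (transpose_mat F * V * F * transpose_mat C * V))"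
    using c F carriers by (simp add: transpose_mult[of F n n "transpose_mat C" n] assoc)
  also have "\<dots> = mat_trace ((transpose_mat F * V * F * transpose_mat C * V) * C)"
    using c F carriers by (intro mat_trace_comm[of _ n n]) auto
  also have "(transpose_mat F * V * F * transpose_mat C * V) * C = transpose_mat F * V * F * (transpose_mat C * V * C)"
    using c F carriers by (simp add: assoc)
  also have "\<dots> = transpose_mat F * V * F * V - transpose_mat F * V * F * Z S"
    unfolding CVC using F carriers
    by (intro mult_minus_distrib_mat[OF _ V_carrier Z(1)]) auto
  also have "mat_trace \<dots> = err F - mat_trace (transpose_mat F * V * F * Z S)"
    using F carriers Z(1) by (intro mat_trace_minus[of _ n]) auto
  also have "\<dots> \<le> err F"
  proof -
    obtain Y where Y: "Y \<in> carrier_mat n n" "Z S = Y * transpose_mat Y" using sketch_Z_gram[OF S] .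
    have "0 \<le> mat_trace (transpose_mat F * V * F * Z S)"
      unfolding Y(2) by (rule mat_trace_weighted_nonneg[OF V_carrier _ F(1) Y(1)]) (rule V_psd)
    then show ?thesis by simp
  qed
  finally show "err ((1\<^sub>m n - W * Z S) * E * (1\<^sub>m n - Z S * W)) \<le> err E - mat_trace (transpose_mat E * Z S * E * V)"
    using 2 by (simp only: F_def C_def Ct[symmetric, unfolded C_def])
qed

section \<open>The error recursions of the two algorithms\<close>

lemma alg1_step_error:
  assumes S: "S \<in> carrier_mat n q" and X: "X \<in> carrier_mat n n"
  shows "alg1_step A W S X \<in> carrier_mat n n"
    and "alg1_step A W S X - B = (1\<^sub>m n - W * Z S) * (X - B)"
proof -
  note Z = sketch_Z[OF S]
  define T where "T = transpose_mat A * S"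
  have T: "T \<in> carrier_mat n q" "transpose_mat T \<in> carrier_mat q n" "transpose_mat S \<in> carrier_mat q n"
    "transpose_mat A \<in> carrier_mat n n"
    using S carriers by (auto simp: T_def)
  define G where "G = mat_inv (transpose_mat T * W * T)"
  have G: "G \<in> carrier_mat q q" using T carriers by (auto simp: G_def intro!: mat_inv_carrier)
  note fac = sketch_factor[OF S, folded T_def, folded G_def]
  have XB: "B - X \<in> carrier_mat n n" using X by (simp add: minus_carrier_mat)
  have "alg1_step A W S X = X + W * transpose_mat A * S * G * transpose_mat S * (1\<^sub>m n - A * X)"
    using A(1) fac(2) by (simp add: alg1_step_def G_def)
  \<comment> \<open>The residual contributes the factor \<open>A\<close> that completes the update
    matrix to \<open>W Z\<close>.\<close>
  also have "1\<^sub>m n - A * X = A * (B - X)"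
    using carriers X by (simp add: mult_minus_distrib_mat[of _ n n _ n])
  also have "W * transpose_mat A * S * G * transpose_mat S * (A * (B - X))
      = W * (T * G * (transpose_mat S * A)) * (B - X)"
  proof -
    have "W * transpose_mat A * S = W * T"
      unfolding T_def by (rule assoc_mult_mat[OF W_carrier T(4) S])
    then show ?thesis
      using T G carriers XB 
      by (simp add: assoc_mult_mat[of _ n q _ q _ n] assoc_mult_mat[of _ n q _ n _ n] assoc_mult_mat[of _ n n _ q _ q]
        assoc_mult_mat[of _ n n _ q _ n] assoc_mult_mat[of _ q n _ n _ n] assoc_mult_mat[of _ q q _ n _ n] assoc)
  qed
  also have "T * G * (transpose_mat S * A) = Z S" using fac by simp
  finally have step: "alg1_step A W S X = X + W * Z S * (B - X)" .
  have WZ: "W * Z S \<in> carrier_mat n n" using Z carriers by simp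
  then show "alg1_step A W S X \<in> carrier_mat n n" unfolding step using X XB by simp
  have "(1\<^sub>m n - W * Z S) * (X - B) = X - B - W * Z S * (X - B)"
    using WZ X carriers by (simp add: minus_mult_distrib_mat[of _ n n _ _ n] minus_carrier_mat del: assoc_mult_mat)
  also have "W * Z S * (X - B) = W * Z S * X - W * Z S * B"
    by (rule mult_minus_distrib_mat[OF WZ X B_carrier])
  finally have 1: "(1\<^sub>m n - W * Z S) * (X - B) = X - B - (W * Z S * X - W * Z S * B)" .
  have 2: "W * Z S * (B - X) = W * Z S * B - W * Z S * X"
    by (rule mult_minus_distrib_mat[OF WZ B_carrier X])
  have "W * Z S * X \<in> carrier_mat n n" "W * Z S * B \<in> carrier_mat n n" using WZ X carriers by auto
  then show "alg1_step A W S X - B = (1\<^sub>m n - W * Z S) * (X - B)"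
    unfolding step 1 2 using X carriers by (intro eq_matI) (auto simp del: assoc_mult_mat index_mult_mat)
qed

text \<open>In terms of the error \<open>E\<close>, the matrix \<open>M_k\<close> is
  \<open>E A\<close> and \<open>A X A - A\<close> is \<open>A E A\<close>, so the four terms of the
  update are those of the expanded two-sided product. Symmetry of \<open>A\<close> and
  \<open>X\<close> makes \<open>E\<close> symmetric, which turns the transposed term into
  \<open>W Z E\<close>.\<close>

lemma alg3_step_error:
  assumes S: "S \<in> carrier_mat n q" and X: "X \<in> carrier_mat n n" and sym: "sym_mat A" "sym_mat X"
  shows "alg3_step A W S X \<in> carrier_mat n n" "sym_mat (alg3_step A W S X)"
    and "alg3_step A W S X - B = (1\<^sub>m n - W * Z S) * (X - B) * (1\<^sub>m n - Z S * W)"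
proof -
  note Z = sketch_Z[OF S]
  have At: "transpose_mat A = A" and Xt: "transpose_mat X = X" using sym by (auto simp: sym_mat_def)
  have Bt: "transpose_mat B = B" using sym_mat_mat_inv[OF A(1) sym(1)] by (simp add: sym_mat_def)
  define E where "E = X - B"
  have E: "E \<in> carrier_mat n n" using carriers by (simp add: E_def minus_carrier_mat)
  have Et: "transpose_mat E = E"
    using transpose_minus[OF X B_carrier] Xt Bt by (simp add: E_def)
  have St: "transpose_mat S \<in> carrier_mat q n" using S by simp
  define G where "G = mat_inv (transpose_mat S * A * W * A * S)"
  have G: "G \<in> carrier_mat q q" using S carriers by (auto simp: G_def intro!: mat_inv_carrier)
  define L where "L = S * G * transpose_mat S"
  have L: "L \<in> carrier_mat n n" using S St G by (simp add: L_def)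
  have ZL: "Z S = A * L * A"
    unfolding sketch_Z_def At G_def[symmetric] L_def using S St G carriers
    by (simp add: assoc_mult_mat[of _ n q _ n _ n] assoc_mult_mat[of _ n n _ q _ q] assoc_mult_mat[of _ n n _ q _ n]
        assoc_mult_mat[of _ n q _ q _ n] assoc_mult_mat[of _ q q _ n _ n] assoc_mult_mat[of _ q n _ n _ n] assoc)
  have EA: "X * A - 1\<^sub>m n = E * A"
    unfolding E_def using X carriers by (simp add: minus_mult_distrib_mat[of _ n n _ _ n])
  have AEA: "A * X * A - A = A * (E * A)"
    unfolding EA[symmetric] using X carriers by (simp add: mult_minus_distrib_mat[of _ n n _ n] assoc)
  \<comment> \<open>This is \<Theta> of the algorithm. It enters through \<open>A Y = Z W\<close>
    and the transposed identity.\<close>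
  define Y where "Y = L * A * W"
  have Y: "Y \<in> carrier_mat n n" using L carriers by (simp add: Y_def)
  have AY: "A * Y = Z S * W" unfolding Y_def ZL using L carriers by (simp add: assoc)
  have YtA: "transpose_mat Y * A = W * Z S"
    using arg_cong[OF AY, of transpose_mat] Y Z carriers
    by (simp add: transpose_mult[of _ n n _ n] At)
  have EAY: "E * A * Y = E * (Z S * W)"
    using assoc_mult_mat[OF E A(1) Y] AY by simp
  have EAYt: "transpose_mat (E * A * Y) = W * Z S * E"
    unfolding EAY using E Z carriers by (simp add: transpose_mult[of _ n n _ n] Et)
  have YAEAY: "transpose_mat Y * (A * (E * A)) * Y = W * Z S * E * (Z S * W)"
  proof -
    have "transpose_mat Y * (A * (E * A)) * Y = (transpose_mat Y * A) * E * (A * Y)"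
      using Y E carriers by (simp add: assoc)
    then show ?thesis unfolding YtA AY .
  qed
  have step: "alg3_step A W S X = X - E * (Z S * W) - W * Z S * E + W * Z S * E * (Z S * W)"
    unfolding alg3_step_def Let_def G_def[symmetric] L_def[symmetric] Y_def[symmetric]
    using A(1) by (simp add: EA AEA EAYt[unfolded EAY] YAEAY EAY del: assoc_mult_mat)
  have c: "E * (Z S * W) \<in> carrier_mat n n" "W * Z S * E \<in> carrier_mat n n"
    "W * Z S * E * (Z S * W) \<in> carrier_mat n n" "Z S * W \<in> carrier_mat n n" "W * Z S \<in> carrier_mat n n"
    using E Z carriers by auto
  then show C: "alg3_step A W S X \<in> carrier_mat n n"
    unfolding step using X by (simp add: minus_carrier_mat del: assoc_mult_mat)
  have "(1\<^sub>m n - W * Z S) * E * (1\<^sub>m n - Z S * W)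
    = E - W * Z S * E - (E * (Z S * W) - W * Z S * E * (Z S * W))"
    using E c by (simp add: mult_minus_distrib_mat[of _ n n _ n] minus_mult_distrib_mat[of _ n n _ _ n] minus_carrier_mat del: assoc_mult_mat)
  moreover have "X - P - Q + R - B = X - B - Q - (P - R)"
    if "P \<in> carrier_mat n n" "Q \<in> carrier_mat n n" "R \<in> carrier_mat n n" for P Q R
    using that X carriers by (intro eq_matI) auto
  ultimately have *: "alg3_step A W S X - B = (1\<^sub>m n - W * Z S) * E * (1\<^sub>m n - Z S * W)"
    unfolding step using c(1-3) by (simp only: E_def)
  then show "alg3_step A W S X - B = (1\<^sub>m n - W * Z S) * (X - B) * (1\<^sub>m n - Z S * W)"
    unfolding E_def .
  \<comment> \<open>The new error is a congruence of the symmetric \<open>E\<close>, hence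
    symmetric; since \<open>B\<close> is symmetric too, so is the new iterate.\<close>
  have "transpose_mat (1\<^sub>m n - Z S * W) = 1\<^sub>m n - W * Z S"
    using c Z carriers by (simp add: transpose_minus[of _ n n] transpose_mult[of _ n n _ n])
  then have "sym_mat ((1\<^sub>m n - W * Z S) * E * (1\<^sub>m n - Z S * W))"
    using sym_mat_congruence[OF E, of "1\<^sub>m n - Z S * W" n] c Et by (simp add: sym_mat_def minus_carrier_mat)
  then have "transpose_mat (alg3_step A W S X - B) = alg3_step A W S X - B"
    unfolding *[symmetric] by (simp add: sym_mat_def)
  then have "transpose_mat (alg3_step A W S X) - B = alg3_step A W S X - B"
    using transpose_minus[OF C B_carrier] Bt by simp
  then have "transpose_mat (alg3_step A W S X) = alg3_step A W S X"
    by (rule minus_mat_right_cancel[OF transpose_carrier_mat[THEN iffD2, OF C] C B_carrier])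
  then show "sym_mat (alg3_step A W S X)" by (simp add: sym_mat_def)
qed

end

subsection \<open>Algebras of measurable matrix-valued functions\<close>

text \<open>It is instantiated twice: with all Borel functions, where the inverse of a Gram matrix
  is available, and with the bounded ones, where products stay integrable. Congruence refers to
  \<Omega> only, because dimensions are values and are known only there.\<close>

locale function_algebra =
  fixes \<Omega> :: "'a set" and F :: "('a \<Rightarrow> real) set"
  assumes const: "(\<lambda>_. c) \<in> F"
    and add: "f \<in> F \<Longrightarrow> g \<in> F \<Longrightarrow> (\<lambda>x. f x + g x) \<in> F"
    and mult: "f \<in> F \<Longrightarrow> g \<in> F \<Longrightarrow> (\<lambda>x. f x * g x) \<in> F"
    and cong: "f \<in> F \<Longrightarrow> (\<And>x. x \<in> \<Omega> \<Longrightarrow> g x = f x) \<Longrightarrow> g \<in> F"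
begin

lemma sum:
  assumes "\<And>i. i \<in> I \<Longrightarrow> (\<lambda>x. f i x) \<in> F"
  shows "(\<lambda>x. \<Sum>i\<in>I. f i x) \<in> F"
  using assms by (induction I rule: infinite_finite_induct) (auto intro: const add)

lemma prod:
  assumes "\<And>i. i \<in> I \<Longrightarrow> (\<lambda>x. f i x) \<in> F"
  shows "(\<lambda>x. \<Prod>i\<in>I. f i x) \<in> F"
  using assms by (induction I rule: infinite_finite_induct) (auto intro: const mult)

lemma diff:
  assumes "f \<in> F" "g \<in> F"
  shows "(\<lambda>x. f x - g x) \<in> F"
  using add[OF assms(1) mult[OF const[of "-1"] assms(2)]] by simp

definition mats :: "nat \<Rightarrow> nat \<Rightarrow> ('a \<Rightarrow> real mat) set" where
  "mats r c = {Y. (\<forall>x\<in>\<Omega>. Y x \<in> carrier_mat r c) \<and> (\<forall>i<r. \<forall>j<c. (\<lambda>x. Y x $$ (i, j)) \<in> F)}"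

lemma mats_carrier: "Y \<in> mats r c \<Longrightarrow> x \<in> \<Omega> \<Longrightarrow> Y x \<in> carrier_mat r c"
  by (simp add: mats_def)

lemma mats_dim:
  "Y \<in> mats r c \<Longrightarrow> x \<in> \<Omega> \<Longrightarrow> dim_row (Y x) = r" "Y \<in> mats r c \<Longrightarrow> x \<in> \<Omega> \<Longrightarrow> dim_col (Y x) = c"
  by (auto simp: mats_def)

lemma mats_entry: "Y \<in> mats r c \<Longrightarrow> i < r \<Longrightarrow> j < c \<Longrightarrow> (\<lambda>x. Y x $$ (i, j)) \<in> F"
  by (simp add: mats_def)

lemma matsI:
  assumes "\<And>x. x \<in> \<Omega> \<Longrightarrow> Y x \<in> carrier_mat r c"
    and "\<And>i j. i < r \<Longrightarrow> j < c \<Longrightarrow> f i j \<in> F"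
    and "\<And>i j x. i < r \<Longrightarrow> j < c \<Longrightarrow> x \<in> \<Omega> \<Longrightarrow> Y x $$ (i, j) = f i j x"
  shows "Y \<in> mats r c"
  unfolding mats_def using assms(1) by (blast intro: cong[OF assms(2) assms(3)])

lemma mats_cong: "Y \<in> mats r c \<Longrightarrow> (\<And>x. x \<in> \<Omega> \<Longrightarrow> Y' x = Y x) \<Longrightarrow> Y' \<in> mats r c"
  by (rule matsI[where f = "\<lambda>i j x. Y x $$ (i, j)"]) (simp_all add: mats_carrier mats_entry)

lemma mats_const: "M \<in> carrier_mat r c \<Longrightarrow> (\<lambda>_. M) \<in> mats r c"
  by (rule matsI[where f = "\<lambda>i j _. M $$ (i, j)"]) (auto intro: const)

lemma mats_mult:
  assumes Y: "Y \<in> mats r m" and Y': "Y' \<in> mats m c"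
  shows "(\<lambda>x. Y x * Y' x) \<in> mats r c"
proof (rule matsI[where f = "\<lambda>i j x. \<Sum>k<m. Y x $$ (i, k) * Y' x $$ (k, j)"])
  fix i j x assume "i < r" "j < c" "x \<in> \<Omega>"
  then show "(Y x * Y' x) $$ (i, j) = (\<Sum>k<m. Y x $$ (i, k) * Y' x $$ (k, j))"
    by (simp add: mats_dim[OF Y] mats_dim[OF Y'] scalar_prod_def atLeast0LessThan)
qed (auto intro!: sum mult mats_entry[OF Y] mats_entry[OF Y'] mult_carrier_mat[OF mats_carrier[OF Y] mats_carrier[OF Y']])

lemma mats_add:
  assumes Y: "Y \<in> mats r c" and Y': "Y' \<in> mats r c"
  shows "(\<lambda>x. Y x + Y' x) \<in> mats r c"
proof (rule matsI[where f = "\<lambda>i j x. Y x $$ (i, j) + Y' x $$ (i, j)"])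
  show "(\<lambda>x. Y x $$ (i, j) + Y' x $$ (i, j)) \<in> F" if "i < r" "j < c" for i j
    using that by (intro add mats_entry[OF Y] mats_entry[OF Y'])
next
  fix x assume "x \<in> \<Omega>"
  note c = mats_carrier[OF Y this] mats_carrier[OF Y' this]
  show "Y x + Y' x \<in> carrier_mat r c" using c by simp
  show "(Y x + Y' x) $$ (i, j) = Y x $$ (i, j) + Y' x $$ (i, j)" if "i < r" "j < c" for i j
    using c that by simp
qed

lemma mats_minus:
  assumes Y: "Y \<in> mats r c" and Y': "Y' \<in> mats r c"
  shows "(\<lambda>x. Y x - Y' x) \<in> mats r c"
proof (rule matsI[where f = "\<lambda>i j x. Y x $$ (i, j) - Y' x $$ (i, j)"])
  show "(\<lambda>x. Y x $$ (i, j) - Y' x $$ (i, j)) \<in> F" if "i < r" "j < c" for i j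
    using that by (intro diff mats_entry[OF Y] mats_entry[OF Y'])
next
  fix x assume "x \<in> \<Omega>"
  note c = mats_carrier[OF Y this] mats_carrier[OF Y' this]
  show "Y x - Y' x \<in> carrier_mat r c" using c(2) by (rule minus_carrier_mat)
  show "(Y x - Y' x) $$ (i, j) = Y x $$ (i, j) - Y' x $$ (i, j)" if "i < r" "j < c" for i j
    using c that by simp
qed

lemma mats_smult:
  assumes f: "f \<in> F" and Y: "Y \<in> mats r c"
  shows "(\<lambda>x. f x \<cdot>\<^sub>m Y x) \<in> mats r c"
proof (rule matsI[where f = "\<lambda>i j x. f x * Y x $$ (i, j)"])
  show "(\<lambda>x. f x * Y x $$ (i, j)) \<in> F" if "i < r" "j < c" for i j
    using that by (intro mult f mats_entry[OF Y])
next
  fix x assume "x \<in> \<Omega>"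
  note c = mats_carrier[OF Y this]
  show "f x \<cdot>\<^sub>m Y x \<in> carrier_mat r c" using c by simp
  show "(f x \<cdot>\<^sub>m Y x) $$ (i, j) = f x * Y x $$ (i, j)" if "i < r" "j < c" for i j
    using c that by simp
qed

lemma mats_transpose:
  assumes Y: "Y \<in> mats r c"
  shows "(\<lambda>x. transpose_mat (Y x)) \<in> mats c r"
proof (rule matsI[where f = "\<lambda>i j x. Y x $$ (j, i)"])
  show "(\<lambda>x. Y x $$ (j, i)) \<in> F" if "i < c" "j < r" for i j
    using that by (intro mats_entry[OF Y])
next
  fix x assume "x \<in> \<Omega>"
  note c = mats_carrier[OF Y this]
  show "transpose_mat (Y x) \<in> carrier_mat c r" using c by simp
  show "transpose_mat (Y x) $$ (i, j) = Y x $$ (j, i)" if "i < c" "j < r" for i j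
    using c that by simp
qed

lemma mats_trace:
  assumes Y: "Y \<in> mats n n"
  shows "(\<lambda>x. mat_trace (Y x)) \<in> F"
proof (rule cong[where f = "\<lambda>x. \<Sum>i<n. Y x $$ (i, i)"])
  show "(\<lambda>x. \<Sum>i<n. Y x $$ (i, i)) \<in> F" by (intro sum mats_entry[OF Y]) auto
qed (simp add: mat_trace_def mats_dim[OF Y])

lemma mats_det:
  assumes Y: "Y \<in> mats n n"
  shows "(\<lambda>x. det (Y x)) \<in> F"
proof (rule cong[where f = "\<lambda>x. \<Sum>p\<in>{p. p permutes {0..<n}}. signof p * (\<Prod>i = 0..<n. Y x $$ (i, p i))"])
  show "(\<lambda>x. \<Sum>p\<in>{p. p permutes {0..<n}}. signof p * (\<Prod>i = 0..<n. Y x $$ (i, p i))) \<in> F"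
    by (intro sum mult prod const mats_entry[OF Y])
      (simp, metis atLeastLessThan_iff le0 mem_Collect_eq permutes_in_image)
qed (use mats_carrier[OF Y] det_def' in blast)

lemma mats_adj_mat:
  assumes Y: "Y \<in> mats n n"
  shows "(\<lambda>x. adj_mat (Y x)) \<in> mats n n"
proof (rule matsI[where f = "\<lambda>i j x. cofactor (Y x) j i"])
  fix i j assume ij: "i < n" "j < n"
  have "(\<lambda>x. mat_delete (Y x) j i) \<in> mats (n - 1) (n - 1)"
  proof (rule matsI[where f = "\<lambda>a b x. Y x $$ (if a < j then a else Suc a, if b < i then b else Suc b)"])
    fix a b x assume "a < n - 1" "b < n - 1" "x \<in> \<Omega>"
    then show "mat_delete (Y x) j i $$ (a, b) = Y x $$ (if a < j then a else Suc a, if b < i then b else Suc b)"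
      by (simp add: mat_delete_def mats_dim[OF Y])
  next
    fix x assume "x \<in> \<Omega>"
    then show "mat_delete (Y x) j i \<in> carrier_mat (n - 1) (n - 1)"
      by (intro mat_delete_carrier mats_carrier[OF Y])
  next
    fix a b assume "a < n - 1" "b < n - 1"
    then show "(\<lambda>x. Y x $$ (if a < j then a else Suc a, if b < i then b else Suc b)) \<in> F"
      by (intro mats_entry[OF Y]) auto
  qed
  then show "(\<lambda>x. cofactor (Y x) j i) \<in> F"
    unfolding cofactor_def by (intro mult const mats_det)
next
  fix x assume x: "x \<in> \<Omega>"
  show "adj_mat (Y x) \<in> carrier_mat n n" by (rule adj_mat(1)[OF mats_carrier[OF Y x]])
  show "adj_mat (Y x) $$ (i, j) = cofactor (Y x) j i" if "i < n" "j < n" for i j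
    using that mats_carrier[OF Y x] by (simp add: adj_mat_def)
qed

end

section \<open>Borel and bounded Borel functions\<close>

lemma function_algebra_borel_measurable: "function_algebra (space M) (borel_measurable M)"
  by unfold_locales (simp_all cong: measurable_cong)

text \<open>Unlike the integrable functions, these are closed under products, and under a finite
  measure they are integrable.\<close>

definition bounded_borel :: "'a measure \<Rightarrow> ('a \<Rightarrow> real) set" where
  "bounded_borel M = {f \<in> borel_measurable M. \<exists>C. \<forall>x\<in>space M. \<bar>f x\<bar> \<le> C}"

lemma function_algebra_bounded_borel: "function_algebra (space M) (bounded_borel M)"
proof
  fix f g :: "'a \<Rightarrow> real" assume "f \<in> bounded_borel M" "g \<in> bounded_borel M"
  then obtain C D where CD: "f \<in> borel_measurable M" "g \<in> borel_measurable M"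
    "\<forall>x\<in>space M. \<bar>f x\<bar> \<le> C" "\<forall>x\<in>space M. \<bar>g x\<bar> \<le> D"
    by (auto simp: bounded_borel_def)
  then have "\<forall>x\<in>space M. \<bar>f x + g x\<bar> \<le> C + D" by (auto intro: order.trans[OF abs_triangle_ineq] add_mono)
  then show "(\<lambda>x. f x + g x) \<in> bounded_borel M" using CD by (auto simp: bounded_borel_def)
  have "\<forall>x\<in>space M. \<bar>f x * g x\<bar> \<le> C * D"
    using CD by (auto simp: abs_mult intro!: mult_mono intro: order.trans[OF abs_ge_zero])
  then show "(\<lambda>x. f x * g x) \<in> bounded_borel M" using CD by (auto simp: bounded_borel_def)
next
  fix f g :: "'a \<Rightarrow> real" assume "f \<in> bounded_borel M" "\<And>x. x \<in> space M \<Longrightarrow> g x = f x"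
  then show "g \<in> bounded_borel M" by (auto simp: bounded_borel_def cong: measurable_cong)
qed (auto simp: bounded_borel_def)

lemma (in finite_measure) integrable_bounded_borel:
  assumes "f \<in> bounded_borel M"
  shows "integrable M f"
proof -
  obtain C where "f \<in> borel_measurable M" "\<forall>x\<in>space M. \<bar>f x\<bar> \<le> C"
    using assms by (auto simp: bounded_borel_def)
  then show ?thesis by (intro integrable_const_bound[of f C] AE_I2) auto
qed

text \<open>The adjugate formula covers singular values as well, since \<open>inverse\<close> is
  Borel on the whole line. The algebra is that of all Borel functions: the factor
  \<open>inverse (det (Y x))\<close> may be unbounded.\<close>

lemma mats_mat_inv:
  assumes Y: "Y \<in> function_algebra.mats (space M) (borel_measurable M) n n"
  shows "(\<lambda>x. mat_inv (Y x)) \<in> function_algebra.mats (space M) (borel_measurable M) n n"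
proof -
  interpret function_algebra "space M" "borel_measurable M" by (rule function_algebra_borel_measurable)
  have "(\<lambda>x. inverse (det (Y x))) \<in> borel_measurable M" using mats_det[OF Y] by simp
  then have *: "(\<lambda>x. inverse (det (Y x)) \<cdot>\<^sub>m adj_mat (Y x)) \<in> mats n n"
    by (intro mats_smult mats_adj_mat Y)
  show ?thesis
    by (rule mats_cong[OF *]) (rule mat_inv_adjugate[OF mats_carrier[OF Y]])
qed

section \<open>Measurability and boundedness of \<open>Z\<close> for a random number of
  columns\<close>

lemma space_mat_borel: "space (mat_borel n) = (\<Union>q. carrier_mat n q)"
  unfolding mat_borel_def by (intro space_measure_of) (auto simp: Pow_def)

lemma sets_mat_borel:
  "carrier_mat n q \<in> sets (mat_borel n)"
  "i < n \<Longrightarrow> j < q \<Longrightarrow> C \<in> sets borel \<Longrightarrow> {S \<in> carrier_mat n q. S $$ (i, j) \<in> C} \<in> sets (mat_borel n)"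
proof -
  let ?G = "range (carrier_mat n) \<union>
      {{S \<in> carrier_mat n q. S $$ (i, j) \<in> B} | q i j B. i < n \<and> j < q \<and> B \<in> sets (borel :: real measure)}"
  have sub: "?G \<subseteq> Pow (\<Union>q. carrier_mat n q)" by auto
  show "carrier_mat n q \<in> sets (mat_borel n)"
    unfolding mat_borel_def by (rule in_measure_of[OF sub]) auto
  show "i < n \<Longrightarrow> j < q \<Longrightarrow> C \<in> sets borel \<Longrightarrow> {S \<in> carrier_mat n q. S $$ (i, j) \<in> C} \<in> sets (mat_borel n)"
    unfolding mat_borel_def by (rule in_measure_of[OF sub]) blast
qed

context sketch_setting
begin

text \<open>The space is a countable union of measurable pieces, one for each number of columns. On
  a piece all dimensions are fixed and the closure properties apply to the formula of
  \<open>Z\<close>.\<close>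

lemma sketch_Z_measurable:
  assumes ij: "i < n" "j < n"
  shows "(\<lambda>S. Z S $$ (i, j)) \<in> borel_measurable (mat_borel n)"
proof (rule measurable_piecewise_restrict)
  show "countable (range (carrier_mat n :: nat \<Rightarrow> real mat set))" by simp
  show "space (mat_borel n) \<subseteq> \<Union> (range (carrier_mat n))" by (simp add: space_mat_borel)
  fix \<Omega> assume "\<Omega> \<in> range (carrier_mat n :: nat \<Rightarrow> real mat set)"
  then obtain q where q: "\<Omega> = carrier_mat n q" by auto
  then show "\<Omega> \<inter> space (mat_borel n) \<in> sets (mat_borel n)"
    using sets_mat_borel(1)[of n q] by auto
  define M where "M = restrict_space (mat_borel n) \<Omega>"
  have spM: "space M = carrier_mat n q"
    by (auto simp: M_def space_restrict_space q space_mat_borel)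
  interpret function_algebra "space M" "borel_measurable M" by (rule function_algebra_borel_measurable)
  have S: "(\<lambda>S. S) \<in> mats n q"
  proof (rule matsI[where f = "\<lambda>i j S. S $$ (i, j)"])
    fix i j assume ij: "i < n" "j < q"
    show "(\<lambda>S. S $$ (i, j)) \<in> borel_measurable M"
    proof (rule measurableI)
      fix C :: "real set" assume C: "C \<in> sets borel"
      have "(\<lambda>S. S $$ (i, j)) -` C \<inter> space M = \<Omega> \<inter> {S \<in> carrier_mat n q. S $$ (i, j) \<in> C}"
        unfolding spM q by auto
      then show "(\<lambda>S. S $$ (i, j)) -` C \<inter> space M \<in> sets M"
        unfolding M_def sets_restrict_space using sets_mat_borel(2)[OF ij C] by auto
    qed simp
  qed (auto simp: spM)
  have At: "transpose_mat A \<in> carrier_mat n n" using carriers by simp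
  note St = mats_transpose[OF S] and const = mats_const[OF A_carrier] mats_const[OF At] mats_const[OF W_carrier]
  have "(\<lambda>S. Z S) \<in> mats n n"
    unfolding sketch_Z_def
    by (intro mats_mult[OF mats_mult[OF mats_mult[OF mats_mult[OF const(2) S]] St] const(1)] mats_mat_inv
        mats_mult[OF mats_mult[OF mats_mult[OF mats_mult[OF St const(1)] const(3)] const(2)] S])
  then show "(\<lambda>S. Z S $$ (i, j)) \<in> borel_measurable (restrict_space (mat_borel n) \<Omega>)"
    using mats_entry ij unfolding M_def by blast
qed

text \<open>The Gram inverse rules out boundedness by closure properties, so the uniform entry bound
  is used. From here on \<open>Z\<close> is treated as an atom, not as a formula in the
  sketch.\<close>

lemma sketch_Z_mats:
  assumes s: "s \<in> measurable M (mat_borel n)"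
  shows "(\<lambda>\<omega>. Z (s \<omega>)) \<in> function_algebra.mats (space M) (bounded_borel M) n n"
proof -
  interpret function_algebra "space M" "bounded_borel M" by (rule function_algebra_bounded_borel)
  have carrier: "\<exists>q. s \<omega> \<in> carrier_mat n q" if "\<omega> \<in> space M" for \<omega>
    using measurable_space[OF s that] by (auto simp: space_mat_borel)
  show ?thesis
  proof (rule matsI[where f = "\<lambda>i j \<omega>. Z (s \<omega>) $$ (i, j)"])
    fix i j assume ij: "i < n" "j < n"
    have "\<bar>Z (s \<omega>) $$ (i, j)\<bar> \<le> V $$ (i, i) + V $$ (j, j)" if "\<omega> \<in> space M" for \<omega>
      using carrier[OF that] sketch_Z_entry_bound ij by blast
    moreover have "(\<lambda>\<omega>. Z (s \<omega>) $$ (i, j)) \<in> borel_measurable M"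
      by (rule measurable_compose[OF s sketch_Z_measurable[OF ij]])
    ultimately show "(\<lambda>\<omega>. Z (s \<omega>) $$ (i, j)) \<in> bounded_borel M"
      by (auto simp: bounded_borel_def)
  qed (use carrier sketch_Z_carrier in auto)
qed

end

subsection \<open>Convergence in expectation\<close>

lemma one_minus_zero_smult_mat: "M \<in> carrier_mat n n \<Longrightarrow> 1\<^sub>m n - 0 \<cdot>\<^sub>m M = (1\<^sub>m n :: real mat)"
  by auto

lemma one_smult_mat [simp]: "1 \<cdot>\<^sub>m M = (M :: real mat)"
  by auto

text \<open>Adaptedness: the iterate with index \<open>k\<close> reads only the sketches with
  smaller index.\<close>

lemma iterates_cong:
  "(\<And>j. j < k \<Longrightarrow> s j = s' j) \<Longrightarrow> iterates step X0 s k = iterates step X0 s' k"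
  by (induction k) auto

text \<open>Cyclicity separates \<open>M\<close> from the error: the trace is linear in the entries
  of \<open>M\<close>, with the entries of \<open>E V E^T\<close> as coefficients. With
  \<open>Z\<close> for \<open>M\<close>, each summand is a product of a function of the new sketch
  and a function of the earlier ones.\<close>

lemma (in sketch_setting) trace_weighted_sum:
  assumes M: "M \<in> carrier_mat n n" and E: "E \<in> carrier_mat n n"
  shows "mat_trace (transpose_mat E * M * E * V) =
    (\<Sum>i<n. \<Sum>j<n. M $$ (i, j) * (E * V * transpose_mat E) $$ (j, i))"
proof -
  have Et: "transpose_mat E \<in> carrier_mat n n" using E by simp
  have "mat_trace (transpose_mat E * M * E * V) = mat_trace (transpose_mat E * (M * (E * V)))"
    using M E Et V_carrier by (simp add: assoc)
  also have "\<dots> = mat_trace (M * (E * V) * transpose_mat E)"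
    using M E Et V_carrier by (intro mat_trace_comm[of _ n n]) auto
  also have "M * (E * V) * transpose_mat E = M * (E * V * transpose_mat E)"
    using M E Et V_carrier by (simp add: assoc)
  also have "mat_trace \<dots> = (\<Sum>i<n. \<Sum>j<n. M $$ (i, j) * (E * V * transpose_mat E) $$ (j, i))"
    using M E Et V_carrier by (intro mat_trace_mult_sum) auto
  finally show ?thesis .
qed

text \<open>
  The factor \<open>c\<close> is \<open>0\<close> for Algorithm 1, whose error is projected from the left only, and \<open>1\<close> for
  Algorithm 3, where it is projected from both sides.
\<close>
locale sketch_iteration = sketch_setting +
  fixes step :: "real mat \<Rightarrow> real mat \<Rightarrow> real mat" and adm :: "real mat \<Rightarrow> bool" and c :: real
  assumes c: "c = 0 \<or> c = 1"
    and step: "\<And>S q X. S \<in> carrier_mat n q \<Longrightarrow> X \<in> carrier_mat n n \<Longrightarrow> adm X \<Longrightarrow>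
      step S X \<in> carrier_mat n n \<and> adm (step S X) \<and>
      step S X - B = (1\<^sub>m n - W * Z S) * (X - B) * (1\<^sub>m n - c \<cdot>\<^sub>m (Z S * W))"
begin

lemma step_err:
  assumes S: "S \<in> carrier_mat n q" and X: "X \<in> carrier_mat n n" "adm X"
  shows "err (step S X - B) \<le> err (X - B) - mat_trace (transpose_mat (X - B) * Z S * (X - B) * V)"
proof -
  have E: "X - B \<in> carrier_mat n n" by (rule minus_carrier_mat[OF B_carrier])
  have ZW: "Z S * W \<in> carrier_mat n n" using sketch_Z_carrier[OF S] W_carrier by simp
  have step': "step S X - B = (1\<^sub>m n - W * Z S) * (X - B) * (1\<^sub>m n - c \<cdot>\<^sub>m (Z S * W))"
    using step[OF S X] by blast
  show ?thesis
  proof (cases "c = 0")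
    case True
    have "1\<^sub>m n - c \<cdot>\<^sub>m (Z S * W) = 1\<^sub>m n"
      unfolding True by (rule one_minus_zero_smult_mat[OF ZW])
    then have "step S X - B = (1\<^sub>m n - W * Z S) * (X - B)"
      unfolding step' by (simp only: right_mult_one_mat[OF mult_carrier_mat[OF sketch_projection(1)[OF S] E]])
    then show ?thesis using err_projection(1)[OF S E] by simp
  next
    case False
    then have "1\<^sub>m n - c \<cdot>\<^sub>m (Z S * W) = 1\<^sub>m n - Z S * W"
      using c by simp
    then show ?thesis unfolding step' using err_projection(2)[OF S E] by simp
  qed
qed

text \<open>By the error recursion the iterates are polynomials in the bounded matrices
  \<open>Z\<close>. The predicate \<open>adm\<close> is carried along because the recursion is
  available only under it. The sketches are kept general, as the lemma is applied to the given
  process and to the coordinates of a product space, where only those with index below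
  \<open>k\<close> are measurable.\<close>

lemma iterates_mats:
  assumes s: "\<And>j. j < k \<Longrightarrow> s j \<in> measurable M (mat_borel n)"
    and X0: "X0 \<in> carrier_mat n n" "adm X0"
  shows "(\<lambda>\<omega>. iterates step X0 (\<lambda>j. s j \<omega>) k) \<in> function_algebra.mats (space M) (bounded_borel M) n n \<and>
    (\<forall>\<omega>\<in>space M. adm (iterates step X0 (\<lambda>j. s j \<omega>) k))"
  using s
proof (induction k)
  case 0
  interpret function_algebra "space M" "bounded_borel M" by (rule function_algebra_bounded_borel)
  show ?case using X0 mats_const by simp
next
  case (Suc k)
  interpret function_algebra "space M" "bounded_borel M" by (rule function_algebra_bounded_borel)
  let ?X = "\<lambda>\<omega>. iterates step X0 (\<lambda>j. s j \<omega>) k"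
  have X: "?X \<in> mats n n" "\<And>\<omega>. \<omega> \<in> space M \<Longrightarrow> adm (?X \<omega>)" using Suc by auto
  have Z: "(\<lambda>\<omega>. Z (s k \<omega>)) \<in> mats n n" using Suc.prems by (intro sketch_Z_mats) auto
  have step': "step (s k \<omega>) (?X \<omega>) \<in> carrier_mat n n \<and> adm (step (s k \<omega>) (?X \<omega>)) \<and>
      step (s k \<omega>) (?X \<omega>) - B = (1\<^sub>m n - W * Z (s k \<omega>)) * (?X \<omega> - B) * (1\<^sub>m n - c \<cdot>\<^sub>m (Z (s k \<omega>) * W))"
    if \<omega>: "\<omega> \<in> space M" for \<omega>
  proof -
    obtain q where "s k \<omega> \<in> carrier_mat n q"
      using measurable_space[OF Suc.prems[OF lessI] \<omega>] by (auto simp: space_mat_borel)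
    then show ?thesis using step[OF _ mats_carrier[OF X(1) \<omega>] X(2)[OF \<omega>]] by blast
  qed
  have *: "(\<lambda>\<omega>. (1\<^sub>m n - W * Z (s k \<omega>)) * (?X \<omega> - B) * (1\<^sub>m n - c \<cdot>\<^sub>m (Z (s k \<omega>) * W)) + B) \<in> mats n n"
    by (intro mats_add[of _ n n] mats_mult[of _ n n] mats_minus[of _ n n] mats_smult mats_const X Z const)
      (use carriers in auto)
  have "(\<lambda>\<omega>. step (s k \<omega>) (?X \<omega>)) \<in> mats n n"
  proof (rule mats_cong[OF *])
    fix \<omega> assume \<omega>: "\<omega> \<in> space M"
    have "M = M - B + B" if "M \<in> carrier_mat n n" for M
      using that B_carrier by (intro eq_matI) auto
    then show "step (s k \<omega>) (?X \<omega>) = (1\<^sub>m n - W * Z (s k \<omega>)) * (?X \<omega> - B) * (1\<^sub>m n - c \<cdot>\<^sub>m (Z (s k \<omega>) * W)) + B"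
      using step'[OF \<omega>] by metis
  qed
  then show ?case using step' by simp
qed

end

section \<open>The expectation of \<open>Z\<close> and the rate\<close>

locale sketch_expectation = sketch_setting +
  fixes D :: "real mat measure"
  assumes n: "0 < n"
    and D: "prob_space D" "sets D = sets (mat_borel n)"
    and EZ: "pos_def n (mat_expectation n D (sketch_Z A W))"
begin

abbreviation "EZ \<equiv> mat_expectation n D Z"
abbreviation "\<rho> \<equiv> 1 - lambda_min (mat_sqrt n W * EZ * mat_sqrt n W)"

lemma EZ_carrier: "EZ \<in> carrier_mat n n"
  by (simp add: mat_expectation_def)

lemma EZ_entry: "i < n \<Longrightarrow> j < n \<Longrightarrow> EZ $$ (i, j) = (\<integral>s. Z s $$ (i, j) \<partial>D)"
  by (simp add: mat_expectation_def)

lemma space_D: "s \<in> space D \<Longrightarrow> \<exists>q. s \<in> carrier_mat n q"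
  using sets_eq_imp_space_eq[OF D(2)] by (simp add: space_mat_borel)

lemma integrable_sketch_Z:
  assumes "i < n" "j < n"
  shows "integrable D (\<lambda>s. Z s $$ (i, j))"
proof -
  interpret D: prob_space D by (rule D)
  interpret function_algebra "space D" "bounded_borel D" by (rule function_algebra_bounded_borel)
  have "(\<lambda>s. s) \<in> measurable D (mat_borel n)" using D(2) by (rule measurable_ident_sets)
  then show ?thesis using D.integrable_bounded_borel mats_entry[OF sketch_Z_mats] assms by blast
qed

lemma integrable_sum_sketch_Z: "integrable D (\<lambda>s. \<Sum>i<n. \<Sum>j<n. Z s $$ (i, j) * y i j)"
  by (intro Bochner_Integration.integrable_sum integrable_mult_left integrable_sketch_Z) auto

lemma integral_sum_sketch_Z:
  "(\<integral>s. (\<Sum>i<n. \<Sum>j<n. Z s $$ (i, j) * y i j) \<partial>D) = (\<Sum>i<n. \<Sum>j<n. EZ $$ (i, j) * y i j)"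
proof -
  have Z: "integrable D (\<lambda>s. Z s $$ (i, j) * y i j)" if "i < n" "j < n" for i j
    by (intro integrable_mult_left integrable_sketch_Z that)
  have "(\<integral>s. (\<Sum>i<n. \<Sum>j<n. Z s $$ (i, j) * y i j) \<partial>D) = (\<Sum>i<n. \<integral>s. (\<Sum>j<n. Z s $$ (i, j) * y i j) \<partial>D)"
    by (intro Bochner_Integration.integral_sum Bochner_Integration.integrable_sum Z) auto
  also have "\<dots> = (\<Sum>i<n. \<Sum>j<n. \<integral>s. Z s $$ (i, j) * y i j \<partial>D)"
    by (intro sum.cong refl Bochner_Integration.integral_sum Z) auto
  also have "\<dots> = (\<Sum>i<n. \<Sum>j<n. EZ $$ (i, j) * y i j)"
    by (simp add: EZ_entry)
  finally show ?thesis .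
qed

text \<open>The expected squared norm of the projection \<open>I - W Z\<close> is nonnegative, and
  the one-step estimate for the error \<open>I\<close> bounds it by \<rho> times the positive number
  \<open>err I\<close>.\<close>

lemma rho_nonneg: "0 \<le> \<rho>"
proof -
  interpret D: prob_space D by (rule D)
  let ?I = "1\<^sub>m n :: real mat"
  let ?Y = "?I * V * transpose_mat ?I"
  have "0 \<le> (\<integral>s. err ?I - (\<Sum>i<n. \<Sum>j<n. Z s $$ (i, j) * ?Y $$ (j, i)) \<partial>D)"
  proof (rule integral_nonneg_AE, rule AE_I2)
    fix s assume "s \<in> space D"
    then obtain q where s: "s \<in> carrier_mat n q" using space_D by blast
    have "0 \<le> err ((1\<^sub>m n - W * Z s) * ?I)"
      using sketch_projection(1)[OF s] by (intro err_nonneg) auto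
    then show "0 \<le> err ?I - (\<Sum>i<n. \<Sum>j<n. Z s $$ (i, j) * ?Y $$ (j, i))"
      unfolding err_projection(1)[OF s one_carrier_mat]
        trace_weighted_sum[OF sketch_Z_carrier[OF s] one_carrier_mat] .
  qed
  also have "\<dots> = err ?I - (\<Sum>i<n. \<Sum>j<n. EZ $$ (i, j) * ?Y $$ (j, i))"
    using Bochner_Integration.integral_diff[OF D.integrable_const integrable_sum_sketch_Z]
    unfolding integral_sum_sketch_Z by (simp add: D.prob_space)
  also have "(\<Sum>i<n. \<Sum>j<n. EZ $$ (i, j) * ?Y $$ (j, i)) = mat_trace (transpose_mat ?I * EZ * ?I * V)"
    by (rule trace_weighted_sum[OF EZ_carrier one_carrier_mat, symmetric])
  also have "err ?I - \<dots> \<le> \<rho> * err ?I"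
    using lambda_min_err[OF EZ_carrier pos_defD(2)[OF EZ] one_carrier_mat] by (simp only: left_diff_distrib mult_1_left)
  finally show ?thesis using err_one_pos[OF n] by (simp add: zero_le_mult_iff)
qed

end

section \<open>Independence and the induction over the iterations\<close>

locale sketch_convergence = sketch_expectation + sketch_iteration +
  fixes P :: "'w measure" and S :: "nat \<Rightarrow> 'w \<Rightarrow> real mat" and X0 :: "real mat"
  assumes P: "prob_space P"
    and indep: "prob_space.indep_vars P (\<lambda>_. mat_borel n) S UNIV"
    and distr: "\<And>j. distr P (mat_borel n) (S j) = D"
    and X0: "X0 \<in> carrier_mat n n" "adm X0"
begin

sublocale P: prob_space P by (rule P)

sublocale bounded: function_algebra "space P" "bounded_borel P"
  by (rule function_algebra_bounded_borel)

abbreviation "X k \<omega> \<equiv> iterates step X0 (\<lambda>j. S j \<omega>) k"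
abbreviation "G k \<omega> \<equiv> (X k \<omega> - B) * V * transpose_mat (X k \<omega> - B)"

lemma S_measurable: "S j \<in> measurable P (mat_borel n)"
  using indep by (simp add: P.indep_vars_def)

lemma X_mats: "X k \<in> bounded.mats n n" and adm_X: "\<omega> \<in> space P \<Longrightarrow> adm (X k \<omega>)"
  using iterates_mats[OF S_measurable X0] by auto

lemma E_mats: "(\<lambda>\<omega>. X k \<omega> - B) \<in> bounded.mats n n"
  by (intro bounded.mats_minus X_mats bounded.mats_const B_carrier)

lemma G_mats: "G k \<in> bounded.mats n n"
  by (intro bounded.mats_mult[of _ n n] bounded.mats_transpose E_mats bounded.mats_const V_carrier)

lemma integrable_err: "integrable P (\<lambda>\<omega>. err (X k \<omega> - B))"
  by (intro P.integrable_bounded_borel bounded.mats_trace[of _ n] bounded.mats_mult[of _ n n] bounded.mats_transpose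
      E_mats bounded.mats_const V_carrier)

text \<open>The two entries are measurable functions of disjoint blocks of the independent family:
  the sketches with index below \<open>k\<close>, and the sketch with index
  \<open>k\<close>.\<close>

lemma indep_Z_G:
  assumes ij: "i < n" "j < n"
  shows "P.indep_var borel (\<lambda>\<omega>. G k \<omega> $$ (j, i)) borel (\<lambda>\<omega>. Z (S k \<omega>) $$ (i, j))"
proof -
  let ?M = "\<lambda>J. PiM J (\<lambda>_. mat_borel n)"
  let ?E = "\<lambda>s. iterates step X0 s k - B"
  interpret function_algebra "space (?M {..<k})" "bounded_borel (?M {..<k})"
    by (rule function_algebra_bounded_borel)
  have ind: "P.indep_var (?M {..<k}) (\<lambda>\<omega>. restrict (\<lambda>j. S j \<omega>) {..<k}) (?M {k}) (\<lambda>\<omega>. restrict (\<lambda>j. S j \<omega>) {k})"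
    by (rule P.indep_var_restrict[OF indep]) auto
  have "(\<lambda>s. iterates step X0 s k) \<in> mats n n"
    using iterates_mats[of k "\<lambda>j s. s j" "?M {..<k}", OF _ X0] by simp
  then have "(\<lambda>s. ?E s * V * transpose_mat (?E s)) \<in> mats n n"
    by (intro mats_mult[of _ n n] mats_transpose mats_minus mats_const V_carrier B_carrier)
  then have 1: "(\<lambda>s. (?E s * V * transpose_mat (?E s)) $$ (j, i)) \<in> borel_measurable (?M {..<k})"
    using mats_entry ij by (fastforce simp: bounded_borel_def)
  have 2: "(\<lambda>s. Z (s k) $$ (i, j)) \<in> borel_measurable (?M {k})"
  proof -
    have "(\<lambda>s. s k) \<in> measurable (?M {k}) (mat_borel n)" by (rule measurable_component_singleton) simp
    then show ?thesis by (rule measurable_compose[OF _ sketch_Z_measurable[OF ij]])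
  qed
  \<comment> \<open>Outside \<open>{..<k}\<close> the restricted family is \<open>undefined\<close>,
    but the iterate never reads those positions.\<close>
  have "iterates step X0 (restrict (\<lambda>j. S j \<omega>) {..<k}) k = X k \<omega>" for \<omega>
    by (rule iterates_cong) simp
  then show ?thesis
    using P.indep_var_compose[OF ind 1 2] by (simp add: o_def)
qed

text \<open>Expectations of products factorize entry by entry, which replaces \<open>Z\<close> by
  \<open>EZ\<close>. The sum is then put back under a single expectation, where the eigenvalue bound
  applies at each outcome.\<close>

lemma expected_err_step:
  "P.expectation (\<lambda>\<omega>. err (X (Suc k) \<omega> - B)) \<le> \<rho> * P.expectation (\<lambda>\<omega>. err (X k \<omega> - B))"
proof -
  let ?E = "\<lambda>\<omega>. X k \<omega> - B"
  have E: "?E \<omega> \<in> carrier_mat n n" for \<omega> by (rule minus_carrier_mat[OF B_carrier])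
  have G: "integrable P (\<lambda>\<omega>. G k \<omega> $$ (j, i))" if "i < n" "j < n" for i j
    using that by (intro P.integrable_bounded_borel bounded.mats_entry[OF G_mats])
  have Z: "integrable P (\<lambda>\<omega>. Z (S k \<omega>) $$ (i, j))" if "i < n" "j < n" for i j
    using that by (intro P.integrable_bounded_borel bounded.mats_entry[OF sketch_Z_mats[OF S_measurable]])
  have EZ_S: "P.expectation (\<lambda>\<omega>. Z (S k \<omega>) $$ (i, j)) = EZ $$ (i, j)" if "i < n" "j < n" for i j
    using integral_distr[OF S_measurable sketch_Z_measurable[OF that], of k] that by (simp add: distr EZ_entry)
  have ZG: "integrable P (\<lambda>\<omega>. Z (S k \<omega>) $$ (i, j) * G k \<omega> $$ (j, i))"
    "P.expectation (\<lambda>\<omega>. Z (S k \<omega>) $$ (i, j) * G k \<omega> $$ (j, i)) = EZ $$ (i, j) * P.expectation (\<lambda>\<omega>. G k \<omega> $$ (j, i))"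
    if "i < n" "j < n" for i j
    using P.indep_var_integrable[OF indep_Z_G G Z] P.indep_var_lebesgue_integral[OF indep_Z_G G Z] that
    by (simp_all add: EZ_S mult.commute)
  have expectation_diff: "P.expectation (\<lambda>\<omega>. err (?E \<omega>) - (\<Sum>i<n. \<Sum>j<n. f i j \<omega>))
      = P.expectation (\<lambda>\<omega>. err (?E \<omega>)) - (\<Sum>i<n. \<Sum>j<n. P.expectation (f i j))"
    if f: "\<And>i j. i < n \<Longrightarrow> j < n \<Longrightarrow> integrable P (f i j)" for f
  proof -
    have row: "integrable P (\<lambda>\<omega>. \<Sum>j<n. f i j \<omega>)" if "i < n" for i
      using that by (intro Bochner_Integration.integrable_sum f) auto
    have "P.expectation (\<lambda>\<omega>. \<Sum>i<n. \<Sum>j<n. f i j \<omega>) = (\<Sum>i<n. P.expectation (\<lambda>\<omega>. \<Sum>j<n. f i j \<omega>))"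
      by (intro Bochner_Integration.integral_sum row) auto
    also have "\<dots> = (\<Sum>i<n. \<Sum>j<n. P.expectation (f i j))"
      by (intro sum.cong refl Bochner_Integration.integral_sum f) auto
    finally show ?thesis
      using Bochner_Integration.integral_diff[OF integrable_err Bochner_Integration.integrable_sum[of "{..<n}"], of "\<lambda>i \<omega>. \<Sum>j<n. f i j \<omega>" k] row
      by simp
  qed
  have "P.expectation (\<lambda>\<omega>. err (X (Suc k) \<omega> - B))
      \<le> P.expectation (\<lambda>\<omega>. err (?E \<omega>) - (\<Sum>i<n. \<Sum>j<n. Z (S k \<omega>) $$ (i, j) * G k \<omega> $$ (j, i)))"
  proof (rule integral_mono[OF integrable_err])
    show "integrable P (\<lambda>\<omega>. err (?E \<omega>) - (\<Sum>i<n. \<Sum>j<n. Z (S k \<omega>) $$ (i, j) * G k \<omega> $$ (j, i)))"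
      by (intro Bochner_Integration.integrable_diff Bochner_Integration.integrable_sum integrable_err ZG(1)) auto
    fix \<omega> assume \<omega>: "\<omega> \<in> space P"
    then obtain q where s: "S k \<omega> \<in> carrier_mat n q"
      using measurable_space[OF S_measurable] by (auto simp: space_mat_borel)
    show "err (X (Suc k) \<omega> - B) \<le> err (?E \<omega>) - (\<Sum>i<n. \<Sum>j<n. Z (S k \<omega>) $$ (i, j) * G k \<omega> $$ (j, i))"
      unfolding trace_weighted_sum[OF sketch_Z_carrier[OF s] E, symmetric] iterates.simps
      by (rule step_err[OF s bounded.mats_carrier[OF X_mats \<omega>] adm_X[OF \<omega>]])
  qed
  also have "\<dots> = P.expectation (\<lambda>\<omega>. err (?E \<omega>)) - (\<Sum>i<n. \<Sum>j<n. EZ $$ (i, j) * P.expectation (\<lambda>\<omega>. G k \<omega> $$ (j, i)))"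
    using expectation_diff[of "\<lambda>i j \<omega>. Z (S k \<omega>) $$ (i, j) * G k \<omega> $$ (j, i)", OF ZG(1)] ZG(2) by simp
  \<comment> \<open>Undoing the factorization: \<open>EZ\<close> is constant, so the sum is again a
    trace for each outcome, now with \<open>EZ\<close> in place of \<open>Z\<close>.\<close>
  also have "\<dots> = P.expectation (\<lambda>\<omega>. err (?E \<omega>) - (\<Sum>i<n. \<Sum>j<n. EZ $$ (i, j) * G k \<omega> $$ (j, i)))"
    using expectation_diff[of "\<lambda>i j \<omega>. EZ $$ (i, j) * G k \<omega> $$ (j, i)", OF integrable_mult_right[OF G]] by simp
  also have "\<dots> \<le> P.expectation (\<lambda>\<omega>. \<rho> * err (?E \<omega>))"
  proof (rule integral_mono)
    show "integrable P (\<lambda>\<omega>. err (?E \<omega>) - (\<Sum>i<n. \<Sum>j<n. EZ $$ (i, j) * G k \<omega> $$ (j, i)))"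
      by (intro Bochner_Integration.integrable_diff Bochner_Integration.integrable_sum integrable_err
          integrable_mult_right G) auto
    show "integrable P (\<lambda>\<omega>. \<rho> * err (?E \<omega>))" by (intro integrable_mult_right integrable_err)
    show "err (?E \<omega>) - (\<Sum>i<n. \<Sum>j<n. EZ $$ (i, j) * G k \<omega> $$ (j, i)) \<le> \<rho> * err (?E \<omega>)" for \<omega>
      unfolding trace_weighted_sum[OF EZ_carrier E, symmetric]
      using diff_left_mono[OF lambda_min_err[OF EZ_carrier pos_defD(2)[OF EZ] E], of "err (?E \<omega>)"]
      by (simp only: left_diff_distrib mult_1_left)
  qed
  finally show ?thesis by simp
qed

lemma expected_err: "P.expectation (\<lambda>\<omega>. err (X k \<omega> - B)) \<le> \<rho> ^ k * err (X0 - B)"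
proof (induction k)
  case 0
  show ?case by (simp add: P.prob_space)
next
  case (Suc k)
  have "P.expectation (\<lambda>\<omega>. err (X (Suc k) \<omega> - B)) \<le> \<rho> * P.expectation (\<lambda>\<omega>. err (X k \<omega> - B))"
    by (rule expected_err_step)
  also have "\<dots> \<le> \<rho> * (\<rho> ^ k * err (X0 - B))" by (intro mult_left_mono Suc.IH rho_nonneg)
  finally show ?case by (simp add: mult.assoc)
qed

lemma convergence:
  shows "integrable P (\<lambda>\<omega>. (weighted_frob_norm V (X k \<omega> - B))\<^sup>2)"
    and "P.expectation (\<lambda>\<omega>. (weighted_frob_norm V (X k \<omega> - B))\<^sup>2) \<le> \<rho> ^ k * (weighted_frob_norm V (X0 - B))\<^sup>2"
  unfolding weighted_frob_norm_power2[OF minus_carrier_mat[OF B_carrier]]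
  by (rule integrable_err, rule expected_err)

end

theorem theorem6p2:
  fixes n k :: nat
    and A W X0 :: "real mat"
    and D :: "real mat measure"
    and P :: "'w measure"
    and S :: "nat \<Rightarrow> 'w \<Rightarrow> real mat"
    and \<rho> :: real
  assumes n: "n \<ge> 1"
    and A: "A \<in> carrier_mat n n" "invertible_mat A"
    and W: "pos_def n W"
    and X0: "X0 \<in> carrier_mat n n"
    and D: "prob_space D" "sets D = sets (mat_borel n)"
    and full_rank: "AE s in D. full_col_rank n s"
    and EZ: "pos_def n (mat_expectation n D (sketch_Z A W))"
    and P: "prob_space P"
    and indep: "prob_space.indep_vars P (\<lambda>_. mat_borel n) S UNIV"
    and distr: "\<And>j. distr P (mat_borel n) (S j) = D"
    and \<rho>: "\<rho> = 1 - lambda_min (mat_sqrt n W * mat_expectation n D (sketch_Z A W) * mat_sqrt n W)"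
  shows
    "(let err = (\<lambda>X. (weighted_frob_norm (mat_inv W) (X - mat_inv A))\<^sup>2);
          X1 = (\<lambda>\<omega>. iterates (alg1_step A W) X0 (\<lambda>j. S j \<omega>) k);
          X3 = (\<lambda>\<omega>. iterates (alg3_step A W) X0 (\<lambda>j. S j \<omega>) k)
      in (integrable P (\<lambda>\<omega>. err (X1 \<omega>)) \<and>
          prob_space.expectation P (\<lambda>\<omega>. err (X1 \<omega>)) \<le> \<rho> ^ k * err X0) \<and>
         (sym_mat A \<and> sym_mat X0 \<longrightarrow>
          integrable P (\<lambda>\<omega>. err (X3 \<omega>)) \<and>
          prob_space.expectation P (\<lambda>\<omega>. err (X3 \<omega>)) \<le> \<rho> ^ k * err X0))"
proof -
  have "0 < n" using n by simp
  interpret sketch_expectation n A W D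
    by (intro sketch_expectation.intro sketch_setting.intro sketch_expectation_axioms.intro A W D EZ \<open>0 < n\<close>)
  interpret one: sketch_convergence n A W D "alg1_step A W" "\<lambda>_. True" 0 P S X0
  proof (intro sketch_convergence.intro sketch_iteration.intro sketch_iteration_axioms.intro
      sketch_convergence_axioms.intro sketch_expectation_axioms sketch_setting_axioms)
    fix T X :: "real mat" and q assume T: "T \<in> carrier_mat n q" and X: "X \<in> carrier_mat n n"
    have ZW: "Z T * W \<in> carrier_mat n n" using sketch_Z_carrier[OF T] W_carrier by simp
    have "(1\<^sub>m n - W * Z T) * (X - B) \<in> carrier_mat n n"
      by (rule mult_carrier_mat[OF sketch_projection(1)[OF T] minus_carrier_mat[OF B_carrier]])
    then show "alg1_step A W T X \<in> carrier_mat n n \<and> True \<and>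
      alg1_step A W T X - B = (1\<^sub>m n - W * Z T) * (X - B) * (1\<^sub>m n - 0 \<cdot>\<^sub>m (Z T * W))"
      using alg1_step_error[OF T X] one_minus_zero_smult_mat[OF ZW] right_mult_one_mat by metis
  qed (rule P indep distr X0 disjI1[OF refl] TrueI)+
  have "integrable P (\<lambda>\<omega>. (weighted_frob_norm V (iterates (alg3_step A W) X0 (\<lambda>j. S j \<omega>) k - B))\<^sup>2) \<and>
      prob_space.expectation P (\<lambda>\<omega>. (weighted_frob_norm V (iterates (alg3_step A W) X0 (\<lambda>j. S j \<omega>) k - B))\<^sup>2)
        \<le> \<rho> ^ k * (weighted_frob_norm V (X0 - B))\<^sup>2"
    if sym: "sym_mat A" "sym_mat X0"
  proof -
    \<comment> \<open>Symmetry of the iterate is the invariant \<open>adm\<close>: \<open>X0\<close>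
      provides it at the start, and \<open>alg3_step_error\<close> preserves it together with the
      two-sided recursion.\<close>
    interpret three: sketch_convergence n A W D "alg3_step A W" sym_mat 1 P S X0
    proof (intro sketch_convergence.intro sketch_iteration.intro sketch_iteration_axioms.intro
      sketch_convergence_axioms.intro sketch_expectation_axioms sketch_setting_axioms)
      fix T X :: "real mat" and q assume T: "T \<in> carrier_mat n q" and X: "X \<in> carrier_mat n n" "sym_mat X"
      show "alg3_step A W T X \<in> carrier_mat n n \<and> sym_mat (alg3_step A W T X) \<and>
        alg3_step A W T X - B = (1\<^sub>m n - W * Z T) * (X - B) * (1\<^sub>m n - 1 \<cdot>\<^sub>m (Z T * W))"
        using alg3_step_error[OF T X(1) sym(1) X(2)] by simp
    qed (rule P indep distr X0 sym disjI2[OF refl])+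
    show ?thesis using three.convergence unfolding \<rho> by blast
  qed
  then show ?thesis
    using one.convergence unfolding \<rho> Let_def by blast
qed

end
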